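(* For every $n\ge 2$ the following three subsets of $\mathbb{TP}^{\binom n1-1}\times\cdots\times\mathbb{TP}^{\binom n{n-1}-1}$ are equal: (1) the totally non-negative tropical complete flag variety $trFl_n^{\ge 0}=\overline{\mathrm{trop}}^{\ge 0}(I_{IP;n})$; (2) the totally non-negative three-term complete flag Dressian $(FlDr_n^{3M})^{\ge 0}$; (3) the totally non-negative complete flag Dressian $FlDr_n^{\ge 0}=\overline{\mathrm{trop}}^{\ge 0}(\mathfrak P_{IP;n})$.
   Context: Let $[n]=\{1,\dots,n\}$. Work in the polynomial ring over $\mathbb{R}$ in variables $P_I$, indexed by subsets $I\subset[n]$ with $1\le |I|\le n-1$. Incidence-Plücker relations: for $1\le r\le s\le n$, $I\subset[n]$ with $|I|=r-1$ and $J\subset[n]$ with $|J|=s+1$, the incidence-Plücker relation is the polynomial $\sum_{j\in J\setminus I}\mathrm{sign}(j,I,J)\,P_{I\cup\{j\}}P_{J\setminus\{j\}}$, where $\mathrm{sign}(j,I,J)=(-1)^{|\{k\in J:\,k<j\}|+|\{i\in I:\,j<i\}|}$. $\mathfrak P_{IP;n}$ denotes the set of all incidence-Plücker relations, and $I_{IP;n}$ the ideal they generate. $\mathfrak P^{3\text{ term}}_{IP;n}$ denotes the set of incidence-Plücker relations with exactly three terms (i.e. $|J\setminus I|=3$). Tropical notions: $\mathbb T=\mathbb R\cup\{\infty\}$. For $m\ge1$, $\mathbb{TP}^{m-1}=(\mathbb T^m\setminus\{(\infty,\dots,\infty)\})/\sim$ where $x\sim y$ iff $x=y+(c,\dots,c)$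 for some $c\in\mathbb R$. Points of $\mathbb{TP}^{\binom n1-1}\times\cdots\times\mathbb{TP}^{\binom n{n-1}-1}$ have coordinates $P_I$, the $k$-th factor having coordinates indexed by the $k$-subsets of $[n]$. For a polynomial $p=\sum_{b} c_b x^{b}$ with real coefficients (written with distinct exponent vectors $b$ and all $c_b\ne 0$) and a point $y$, the value of the term $c_bx^b$ at $y$ is $b\cdot y$ (with $0\cdot\infty=0$; real coefficients contribute nothing). The point $y$ is a solution of the tropicalization of $p$ if the minimum of the term values is attained by at least two terms; it is a positive solution if moreover the minimum is attained by at least one term with $c_b>0$ and at least one term with $c_b<0$. For multihomogeneous $p$ these notions are well defined on the product of tropical projective spaces. For a set (or ideal) $\mathcal P$ of such polynomials, $\overline{\mathrm{trop}}(\mathcal P)$ is the set of points that are solutions of the tropicalizations of all $p\in\mathcal P$, and $\overline{\mathrm{trop}}^{\ge0}(\mathcal P)$ the set of points that are positive solutions of the tropicalizations of all $p\in\mathcal P$. The support of a point $P$ is $\{I: P_I\ne\infty\}$. A (complete) flag matroid on $[n]$ is a sequence $(\mathcal M_1,\dots,\mathcal M_{n-1})$ of matroids on $[n]$ with $\mathrm{rank}\,\mathcal M_i=i$ such that for all $j<k$ every basis of $\mathcal M_j$ is contained in some basis of $\mathcal M_k$ and every basis of $\mathcal M_k$ contains some basis of $\mathcal M_j$; a set of subsets "forms a flag matroid" if, for each $k$, its $k$-element members are the bases of $\mathcal M_k$ for such a flag matroid. $(FlDr_n^{3M})^{\ge0}$ is the set of points of $\overline{\mathrm{trop}}^{\ge0}(\mathfrak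 P^{3\text{ term}}_{IP;n})$ whose support forms a flag matroid. *)

theory Defs
  imports Complex_Main "HOL-Library.Poly_Mapping" "HOL-Library.Extended_Real"
begin

(* Polynomials over R in variables P_I (I :: nat set): finitely supported maps from
   monomials (exponent vectors nat set \<Rightarrow>\<^sub>0 nat) to real coefficients. *)
type_synonym mpoly = "(nat set \<Rightarrow>\<^sub>0 nat) \<Rightarrow>\<^sub>0 real"

definition Var :: "nat set \<Rightarrow> mpoly" where
  "Var I = Poly_Mapping.single (Poly_Mapping.single I 1) 1"

definition idx :: "nat \<Rightarrow> nat set set" where
  "idx n = {I. I \<subseteq> {1..n} \<and> 1 \<le> card I \<and> card I \<le> n - 1}"

definition ip_sign :: "nat \<Rightarrow> nat set \<Rightarrow> nat set \<Rightarrow> int" where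
  "ip_sign j I J = (-1) ^ (card {k\<in>J. k < j} + card {i\<in>I. j < i})"

definition ip_rel :: "nat set \<Rightarrow> nat set \<Rightarrow> mpoly" where
  "ip_rel I J = (\<Sum>j\<in>J - I. of_int (ip_sign j I J) * Var (I \<union> {j}) * Var (J - {j}))"

definition IP_rels :: "nat \<Rightarrow> mpoly set" where
  "IP_rels n = {ip_rel I J | I J r s. 1 \<le> r \<and> r \<le> s \<and> s \<le> n \<and>
      I \<subseteq> {1..n} \<and> card I = r - 1 \<and> J \<subseteq> {1..n} \<and> card J = s + 1}"

definition IP_rels3 :: "nat \<Rightarrow> mpoly set" where
  "IP_rels3 n = {ip_rel I J | I J r s. 1 \<le> r \<and> r \<le> s \<and> s \<le> n \<and>
      I \<subseteq> {1..n} \<and> card I = r - 1 \<and> J \<subseteq> {1..n} \<and> card J = s + 1 \<and>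
      card (J - I) = 3}"

inductive_set ideal_gen :: "mpoly set \<Rightarrow> mpoly set" for G where
  zero: "0 \<in> ideal_gen G"
| step: "g \<in> G \<Longrightarrow> p \<in> ideal_gen G \<Longrightarrow> c * g + p \<in> ideal_gen G"

(* value of the monomial with exponent vector b at the point y (coefficients contribute nothing) *)
definition term_val :: "(nat set \<Rightarrow> ereal) \<Rightarrow> (nat set \<Rightarrow>\<^sub>0 nat) \<Rightarrow> ereal" where
  "term_val y b = (\<Sum>I\<in>Poly_Mapping.keys b. ereal (real (Poly_Mapping.lookup b I)) * y I)"

definition min_val :: "(nat set \<Rightarrow> ereal) \<Rightarrow> mpoly \<Rightarrow> ereal" where
  "min_val y p = Min (term_val y ` Poly_Mapping.keys p)"

definition trop_sol :: "(nat set \<Rightarrow> ereal) \<Rightarrow> mpoly \<Rightarrow> bool" where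
  "trop_sol y p \<longleftrightarrow> (\<exists>b1\<in>Poly_Mapping.keys p. \<exists>b2\<in>Poly_Mapping.keys p. b1 \<noteq> b2 \<and>
      term_val y b1 = min_val y p \<and> term_val y b2 = min_val y p)"

definition trop_pos_sol :: "(nat set \<Rightarrow> ereal) \<Rightarrow> mpoly \<Rightarrow> bool" where
  "trop_pos_sol y p \<longleftrightarrow> trop_sol y p \<and>
     (\<exists>b\<in>Poly_Mapping.keys p. term_val y b = min_val y p \<and> Poly_Mapping.lookup p b > 0) \<and>
     (\<exists>b\<in>Poly_Mapping.keys p. term_val y b = min_val y p \<and> Poly_Mapping.lookup p b < 0)"

(* representatives of points of TP^{C(n,1)-1} x ... x TP^{C(n,n-1)-1}:
   values in T = R \<union> {\<infinity>}, coordinates outside idx n fixed to \<infinity> (unused),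
   and each factor has a finite coordinate *)
definition points :: "nat \<Rightarrow> (nat set \<Rightarrow> ereal) set" where
  "points n = {y. (\<forall>I. y I \<noteq> -\<infinity>) \<and> (\<forall>I. I \<notin> idx n \<longrightarrow> y I = \<infinity>) \<and>
      (\<forall>k\<in>{1..n-1}. \<exists>I\<in>idx n. card I = k \<and> y I \<noteq> \<infinity>)}"

definition trop_pos :: "nat \<Rightarrow> mpoly set \<Rightarrow> (nat set \<Rightarrow> ereal) set" where
  "trop_pos n G = {y \<in> points n. \<forall>p\<in>G. p \<noteq> 0 \<longrightarrow> trop_pos_sol y p}"

definition supp :: "(nat set \<Rightarrow> ereal) \<Rightarrow> nat set set" where
  "supp y = {I. y I \<noteq> \<infinity>}"

definition matroid_bases :: "nat set \<Rightarrow> nat set set \<Rightarrow> bool" where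
  "matroid_bases E B \<longleftrightarrow> B \<noteq> {} \<and> (\<forall>X\<in>B. X \<subseteq> E) \<and>
     (\<forall>B1\<in>B. \<forall>B2\<in>B. \<forall>x\<in>B1 - B2. \<exists>y\<in>B2 - B1. insert y (B1 - {x}) \<in> B)"

definition forms_flag_matroid :: "nat \<Rightarrow> nat set set \<Rightarrow> bool" where
  "forms_flag_matroid n S \<longleftrightarrow>
     (\<forall>k\<in>{1..n-1}. matroid_bases {1..n} {I\<in>S. card I = k} \<and>
                   (\<forall>X\<in>{I\<in>S. card I = k}. card X = k)) \<and>
     (\<forall>j\<in>{1..n-1}. \<forall>k\<in>{1..n-1}. j < k \<longrightarrow>
        (\<forall>X\<in>{I\<in>S. card I = j}. \<exists>Y\<in>{I\<in>S. card I = k}. X \<subseteq> Y) \<and>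
        (\<forall>Y\<in>{I\<in>S. card I = k}. \<exists>X\<in>{I\<in>S. card I = j}. X \<subseteq> Y))"

definition FlDr3M_pos :: "nat \<Rightarrow> (nat set \<Rightarrow> ereal) set" where
  "FlDr3M_pos n = {y \<in> trop_pos n (IP_rels3 n). forms_flag_matroid n (supp y)}"

end

theory Submission
  imports Defs "HOL-Analysis.Extended_Real_Limits"
begin

text \<open>
  A point solves a tropicalized incidence relation positively iff every finite term is dominated by
  a term of the opposite sign. In this form the three-term relations imply all others: an
  incidence relation for \<open>(I, J)\<close> is traded, through three-term relations, against shorter ones in
  which one element \<open>u\<close> of \<open>I - J\<close> is replaced (or, if \<open>I \<subseteq> J\<close>, in which \<open>I\<close> grows), the support being
  a flag matroid guaranteeing that a finite pivot exists.

  The set of points satisfying all incidence relations is stable under the tropical elementary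
  column operations \<open>e\<^sub>q \<mapsto> e\<^sub>q + t\<^sup>c e\<^sub>p\<close> with \<open>p\<close>, \<open>q\<close> adjacent. These enlarge the support and tend to
  the identity as \<open>c\<close> tends to infinity, and being a positive solution is a closed condition; so one
  may assume that all coordinates are finite. A finite point is determined by its values on
  intervals, where the three-term relations act as subtraction-free recursions. Hence it is the
  tropicalization of the flag minors of real matrices depending on \<open>x\<close>, namely those whose interval
  minors are \<open>exp (- x y)\<close>, and any polynomial in the ideal vanishes on these minors.
\<close>

section \<open>Exchange from three-term relations\<close>

text \<open>The three-term recursions divide by a coordinate, so a lift is built only where
  everything is finite, and points with infinite coordinates have to be approached. Replacing
  infinite entries by large numbers need not respect the relations; a column operation acts on
  actual minors and therefore does. Between adjacent columns it introduces no sign, which keeps it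
  positive. The three-term family alone is too small for this: exchanging an element
  \<open>q\<close> of both I and J for some \<open>p\<close> outside I and J turns a set
  \<open>J - I\<close> of three elements into one of four. This is why all incidence relations are
  derived combinatorially before any lift. In that derivation pivots could be traded for one another
  in a circle; the weights \<open>l\<close> and the choice of the farthest minimal pivot in
  \<open>sign_exchange\<close> exclude this. In the lift, t = exp (-x), and the valuation of a
  positive function f is the limit of - ln (f x) / x, so real functions take the place of Puiseux
  series; positivity makes the valuation of a sum the minimum.\<close>

lemma balancing_shift:
  fixes p q :: real and a b :: ereal
  assumes "a \<noteq> -\<infinity>" "b \<noteq> -\<infinity>" "ereal p + ereal q \<le> a + b"
  shows "\<exists>l::real. ereal p \<le> a + ereal l \<and> ereal q \<le> b - ereal l \<and>
    (ereal p + ereal q < a + b \<longrightarrow> ereal p < a + ereal l \<and> ereal q < b - ereal l)"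
proof (cases a)
  case (real ra)
  note ra = this
  show ?thesis
  proof (cases b)
    case (real rb)
    \<comment> \<open>The admissible \<open>l\<close> form the interval from \<open>p - ra\<close>
      to \<open>rb - q\<close>; its midpoint is strictly inside whenever the sum inequality is
      strict.\<close>
    show ?thesis
      by (rule exI[of _ "((p - ra) + (rb - q)) / 2"]) (use real ra assms in \<open>auto simp: field_simps\<close>)
  next
    case PInf
    show ?thesis by (rule exI[of _ "p - ra + 1"]) (use PInf ra in auto)
  qed (use assms in auto)
next
  case PInf
  show ?thesis
  proof (cases b)
    case (real rb)
    show ?thesis by (rule exI[of _ "rb - q - 1"]) (use real PInf in auto)
  qed (use PInf assms in auto)
qed (use assms in auto)

text \<open>This is the trade of one incidence relation for shorter ones, stripped of sets. The term
  of \<open>k\<close> has the factors \<open>a k\<close> and \<open>b k\<close>;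
  \<open>g v k\<close> stands for the coordinate in which a pivot \<open>v\<close> has taken part of
  the role of I. \<open>three\<close> is the three-term relation in the order \<open>\<rho>\<close>,
  \<open>sub\<close> the shorter relation with pivot \<open>v\<close>, and \<open>ex\<close>
  provides a finite pivot. If the claim failed, a cheapest term \<open>j\<close> would strictly beat
  all terms of opposite sign; \<open>sub\<close> at a well-chosen pivot then produces a
  \<open>k\<close> contradicting this or the choice of the pivot.\<close>

lemma sign_exchange:
  fixes a b :: "'a \<Rightarrow> ereal" and g :: "'a \<Rightarrow> 'a \<Rightarrow> ereal" and \<rho> :: "'a \<Rightarrow> nat" and \<epsilon> :: "'a \<Rightarrow> bool"
  assumes fin: "finite S" and inj: "inj_on \<rho> S"
    and ninf: "\<And>x. a x \<noteq> -\<infinity>" "\<And>x. b x \<noteq> -\<infinity>" "\<And>x y. g x y \<noteq> -\<infinity>"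
    and sym: "\<And>x y. g x y = g y x"
    and three: "\<And>x y z. \<lbrakk>x \<in> S; y \<in> S; z \<in> S; \<rho> x < \<rho> y; \<rho> y < \<rho> z\<rbrakk>
      \<Longrightarrow> a y + g x z = min (a x + g y z) (a z + g x y)"
    and sub: "\<And>v j. \<lbrakk>v \<in> S; j \<in> S; j \<noteq> v; b j + g v j < \<infinity>\<rbrakk>
      \<Longrightarrow> \<exists>k\<in>S - {v}. (\<epsilon> k = \<epsilon> j \<longleftrightarrow> (\<rho> k < \<rho> v) \<noteq> (\<rho> j < \<rho> v)) \<and> b k + g v k \<le> b j + g v j"
    and ex: "\<And>j. \<lbrakk>j \<in> S; a j + b j < \<infinity>\<rbrakk> \<Longrightarrow> \<exists>v\<in>S - {j}. g j v < \<infinity>"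
    and j0: "j0 \<in> S" "a j0 + b j0 < \<infinity>"
  shows "\<exists>k\<in>S. \<epsilon> k \<noteq> \<epsilon> j0 \<and> a k + b k \<le> a j0 + b j0"
proof (rule ccontr)
  assume neg: "\<not> ?thesis"
  define f where "f k = a k + b k" for k
  have opp0: "f j0 < f k" if "k \<in> S" "\<epsilon> k \<noteq> \<epsilon> j0" for k
    using neg that by (auto simp: f_def not_le)
  define j where "j = arg_min_on f {k \<in> S. \<epsilon> k = \<epsilon> j0}"
  have ne: "finite {k \<in> S. \<epsilon> k = \<epsilon> j0}" "{k \<in> S. \<epsilon> k = \<epsilon> j0} \<noteq> {}" using fin j0 by auto
  have jS: "j \<in> S" "\<epsilon> j = \<epsilon> j0"
    using arg_min_if_finite(1)[OF ne, of f] by (auto simp: j_def)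
  have jle: "f j \<le> f k" if "k \<in> S" "\<epsilon> k = \<epsilon> j" for k
    using arg_min_least[OF ne, of k f] that jS by (auto simp: j_def)
  have jlt: "f j < f k" if "k \<in> S" "\<epsilon> k \<noteq> \<epsilon> j" for k
    using jle[OF j0(1)] opp0[OF that(1)] that jS by (auto intro: le_less_trans)
  have jmin: "f j \<le> f k" if "k \<in> S" for k using jle[OF that] jlt[OF that] by (cases "\<epsilon> k = \<epsilon> j") auto
  have fj: "f j < \<infinity>" using jle[OF j0(1)] jS j0 by (auto simp: f_def intro: le_less_trans)
  obtain p q where pq: "a j = ereal p" "b j = ereal q"
    using fj ninf(1)[of j] ninf(2)[of j] by (cases "a j"; cases "b j") (auto simp: f_def)
  \<comment> \<open>The inequality \<open>f j \<le> f v\<close> is split between the two factors.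
    The real \<open>l v\<close> acts as a potential that makes the pivots comparable even where
    \<open>a v\<close> or \<open>b v\<close> is infinite.\<close>
  have "\<forall>v\<in>S. \<exists>l::real. a j \<le> a v + ereal l \<and> b j \<le> b v - ereal l \<and>
    (f j < f v \<longrightarrow> a j < a v + ereal l \<and> b j < b v - ereal l)"
    using balancing_shift[OF ninf(1) ninf(2)] jmin by (auto simp: f_def pq)
  then obtain l :: "'a \<Rightarrow> real" where
    l: "\<And>v. v \<in> S \<Longrightarrow> a j \<le> a v + ereal (l v)" "\<And>v. v \<in> S \<Longrightarrow> b j \<le> b v - ereal (l v)"
       "\<And>v. v \<in> S \<Longrightarrow> f j < f v \<Longrightarrow> b j < b v - ereal (l v)"
    by metis
  define h where "h v = g j v + ereal (l v)" for v
  \<comment> \<open>Ties among the pivots minimising \<open>h\<close> are broken by distance from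
    \<open>j\<close>; this excludes case C below.\<close>
  define dist where "dist v = \<bar>int (\<rho> v) - int (\<rho> j)\<bar>" for v
  define m where "m = Min (h ` (S - {j}))"
  obtain v1 where v1: "v1 \<in> S - {j}" "g j v1 < \<infinity>" using ex jS(1) fj by (auto simp: f_def)
  have finj: "finite (S - {j})" "S - {j} \<noteq> {}" using fin v1 by auto
  have mle: "m \<le> h v" if "v \<in> S" "v \<noteq> j" for v unfolding m_def using that finj by (intro Min_le) auto
  define M where "M = {v \<in> S - {j}. h v = m}"
  have "m \<in> h ` (S - {j})" unfolding m_def using finj by (intro Min_in) auto
  then have "M \<noteq> {}" "finite M" using fin by (auto simp: M_def)
  then have "Max (dist ` M) \<in> dist ` M" by (intro Max_in) auto
  then obtain v where v: "v \<in> M" "dist v = Max (dist ` M)" by auto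
  have vmax: "dist w \<le> dist v" if "w \<in> M" for w unfolding v using that \<open>finite M\<close> by (intro Max_ge) auto
  have vS: "v \<in> S" "v \<noteq> j" "h v = m" using v by (auto simp: M_def)
  have gfin: "g j v < \<infinity>"
    using mle[of v1] v1 vS by (cases "g j v") (auto simp: h_def)
  then obtain G where G: "g j v = ereal G" using ninf(3)[of j v] by (cases "g j v") auto
  obtain k where k: "k \<in> S" "k \<noteq> v" "\<epsilon> k = \<epsilon> j \<longleftrightarrow> (\<rho> k < \<rho> v) \<noteq> (\<rho> j < \<rho> v)"
      "b k + g v k \<le> b j + g v j"
    using sub[OF vS(1) jS(1) vS(2)[symmetric]] gfin pq sym[of v j] G by auto
  have kj: "k \<noteq> j" using k(3) by auto
  have \<rho>: "\<rho> k \<noteq> \<rho> v" "\<rho> k \<noteq> \<rho> j" "\<rho> v \<noteq> \<rho> j"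
    using inj k(1,2) kj vS jS by (auto dest: inj_onD)
  obtain K L where KL: "b k = ereal K" "g v k = ereal L"
    using k(4) G pq sym[of v j] ninf(2)[of k] ninf(3)[of v k] by (cases "b k"; cases "g v k") auto
  have KLle: "K + L \<le> q + G" using k(4) KL pq G sym[of v j] by simp
  \<comment> \<open>Adding the assumed inequality, the one from \<open>sub\<close> and the shifts at
    \<open>v\<close> and \<open>k\<close> gives \<open>h k \<le> h v\<close>. Minimality of
    \<open>h v = m\<close> turns all of them into equalities, so the strict shift at
    \<open>k\<close> is impossible.\<close>
  have key: "h k = m \<and> \<not> f j < f k" if asm: "a v + g j k \<le> a j + g v k"
  proof -
    obtain V W where VW: "a v = ereal V" "g j k = ereal W"
      using asm KL pq ninf(1)[of v] ninf(3)[of j k] by (cases "a v"; cases "g j k") auto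
    have 1: "V + W \<le> p + L" using asm VW pq KL by simp
    have 2: "p \<le> V + l v" using l(1)[OF vS(1)] VW pq by simp
    have 3: "q \<le> K - l k" using l(2)[OF k(1)] KL pq by simp
    have 4: "G + l v \<le> W + l k" using mle[OF k(1) kj] G VW by (simp add: h_def flip: vS(3))
    have 5: "f j < f k \<Longrightarrow> q < K - l k" using l(3)[OF k(1)] KL pq by simp
    have "W + l k = G + l v" "\<not> q < K - l k" using 1 2 3 4 KLle by linarith+
    with 5 show ?thesis using vS(3) G VW by (auto simp: h_def)
  qed
  have far: "a k + g j v \<le> a j + g v k \<Longrightarrow> \<epsilon> k \<noteq> \<epsilon> j \<Longrightarrow> False"
  proof -
    assume *: "a k + g j v \<le> a j + g v k" "\<epsilon> k \<noteq> \<epsilon> j"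
    then obtain R where R: "a k = ereal R" using KL G pq ninf(1)[of k] by (cases "a k") auto
    have "f j < f k" using jlt[OF k(1)] * by simp
    then show False using * R KL pq G KLle by (simp add: f_def)
  qed
  \<comment> \<open>The cases ask which of \<open>j\<close>, \<open>k\<close>, \<open>v\<close> is
    in the middle. In A and B, \<open>j\<close> and \<open>k\<close> are on the same side of
    \<open>v\<close> and have opposite signs; in C the signs agree, and \<open>k\<close> is a
    minimal pivot farther from \<open>j\<close> than \<open>v\<close>.\<close>
  consider (A) "(\<rho> j < \<rho> k \<and> \<rho> k < \<rho> v) \<or> (\<rho> v < \<rho> k \<and> \<rho> k < \<rho> j)"
    | (B) "(\<rho> k < \<rho> j \<and> \<rho> j < \<rho> v) \<or> (\<rho> v < \<rho> j \<and> \<rho> j < \<rho> k)"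
    | (C) "(\<rho> j < \<rho> v \<and> \<rho> v < \<rho> k) \<or> (\<rho> k < \<rho> v \<and> \<rho> v < \<rho> j)"
    using \<rho> by linarith
  then show False
  proof cases
    case A
    then have e: "a k + g j v = min (a j + g v k) (a v + g j k)"
      using three[of j k v] three[of v k j] k(1) jS vS sym by (auto simp: min.commute)
    have "\<epsilon> k \<noteq> \<epsilon> j" using k(3) A by auto
    then show False using far e by simp
  next
    case B
    then have e: "a j + g v k = min (a k + g j v) (a v + g j k)"
      using three[of k j v] three[of v j k] k(1) jS vS sym by (auto simp: min.commute)
    have opp: "\<epsilon> k \<noteq> \<epsilon> j" using k(3) B by auto
    show False
    proof (cases "a k + g j v \<le> a v + g j k")
      case True
      then show False using far opp e by simp
    next
      case False
      then have "a v + g j k \<le> a j + g v k" using e by simp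
      from key[OF this] show False using jlt[OF k(1) opp] by simp
    qed
  next
    case C
    then have e: "a v + g j k = min (a j + g v k) (a k + g j v)"
      using three[of j v k] three[of k v j] k(1) jS vS sym by (auto simp: min.commute)
    have "h k = m" using key e by simp
    then have "k \<in> M" using k(1) kj by (simp add: M_def)
    from vmax[OF this] C show False by (auto simp: dist_def)
  qed
qed


section \<open>Signs, positive relations and flag matroid exchange\<close>

definition even_sign :: "nat \<Rightarrow> nat set \<Rightarrow> nat set \<Rightarrow> bool" where
  "even_sign j I J \<longleftrightarrow> even (card {k\<in>J. k < j} + card {i\<in>I. j < i})"

lemma card_Collect_insert:
  assumes "finite A" "x \<notin> A"
  shows "card {k \<in> insert x A. P k} = card {k \<in> A. P k} + (if P x then 1 else 0)"
proof -
  have "{k \<in> insert x A. P k} = (if P x then insert x {k \<in> A. P k} else {k \<in> A. P k})" by auto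
  then show ?thesis using assms by auto
qed

lemma card_Collect_three:
  assumes "p \<noteq> q" "q \<noteq> r" "p \<noteq> r"
  shows "card {k\<in>{p,q,r}. P k} = (if P p then 1 else 0) + (if P q then 1 else 0) + (if P r then 1 else 0)"
proof -
  have "card {k\<in>{p,q,r}. P k} = card {k\<in>{q,r}. P k} + (if P p then 1 else 0)"
    using assms by (intro card_Collect_insert) auto
  moreover have "card {k\<in>{q,r}. P k} = card {k\<in>{r}. P k} + (if P q then 1 else 0)"
    using assms by (intro card_Collect_insert) auto
  moreover have "{k\<in>{r}. P k} = (if P r then {r} else {})" by auto
  ultimately show ?thesis by (simp only: card_1_singleton_iff split: if_split) simp
qed

lemma card_Collect_Un:
  assumes "finite A" "finite B" "A \<inter> B = {}"
  shows "card {k \<in> A \<union> B. P k} = card {k \<in> A. P k} + card {k \<in> B. P k}"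
proof -
  have "{k \<in> A \<union> B. P k} = {k \<in> A. P k} \<union> {k \<in> B. P k}" by auto
  then show ?thesis using assms by (simp add: card_Un_disjoint disjoint_iff)
qed

lemma card_below_above:
  fixes x :: nat
  assumes "finite A" "x \<notin> A"
  shows "card {k\<in>A. k < x} + card {k\<in>A. x < k} = card A"
proof -
  have "A = {k\<in>A. k < x} \<union> {k\<in>A. x < k}" using assms(2) by (auto simp: not_less_iff_gr_or_eq)
  then have "card A = card ({k\<in>A. k < x} \<union> {k\<in>A. x < k})" by simp
  also have "\<dots> = card {k\<in>A. k < x} + card {k\<in>A. x < k}"
    using assms(1) by (intro card_Un_disjoint) auto
  finally show ?thesis by simp
qed

text \<open>Each common element is either below \<open>x\<close>, counted in J, or above
  \<open>x\<close>, counted in I. Together they contribute the constant \<open>card A\<close>, so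
  only \<open>U\<close> and \<open>W\<close> distinguish the terms.\<close>

lemma even_sign_common_part:
  assumes "finite A" "finite U" "finite W" "A \<inter> U = {}" "A \<inter> W = {}" "x \<notin> A"
  shows "even_sign x (A \<union> U) (A \<union> W) \<longleftrightarrow> even (card A + card {k\<in>W. k < x} + card {i\<in>U. x < i})"
proof -
  have "card {k\<in>A \<union> W. k < x} + card {i\<in>A \<union> U. x < i} =
      card A + card {k\<in>W. k < x} + card {i\<in>U. x < i}"
    using card_below_above[OF assms(1,6)] card_Collect_Un[OF assms(1,3,5)] card_Collect_Un[OF assms(1,2,4)] by simp
  then show ?thesis by (simp add: even_sign_def)
qed

definition pos_rel :: "(nat set \<Rightarrow> ereal) \<Rightarrow> nat set \<Rightarrow> nat set \<Rightarrow> bool" where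
  "pos_rel y I J \<longleftrightarrow> (\<forall>j\<in>J - I. y (insert j I) + y (J - {j}) < \<infinity> \<longrightarrow>
     (\<exists>k\<in>J - I. even_sign k I J \<noteq> even_sign j I J \<and>
        y (insert k I) + y (J - {k}) \<le> y (insert j I) + y (J - {j})))"

text \<open>With \<open>card I = r - 1\<close> and \<open>card J = s + 1\<close> the condition
  \<open>r \<le> s\<close> becomes this inequality; conversely r and s are \<open>card I + 1\<close>
  and \<open>card J - 1\<close>.\<close>

definition ip_pair :: "nat \<Rightarrow> nat set \<Rightarrow> nat set \<Rightarrow> bool" where
  "ip_pair n I J \<longleftrightarrow> I \<subseteq> {1..n} \<and> J \<subseteq> {1..n} \<and> card I + 2 \<le> card J"

lemma ip_pair_finite: "ip_pair n I J \<Longrightarrow> finite I \<and> finite J"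
  by (auto simp: ip_pair_def intro: finite_subset)

lemma ip_pair_card_Diff:
  assumes "ip_pair n I J"
  shows "2 \<le> card (J - I)" "card (J - I) = 2 \<Longrightarrow> I \<subseteq> J"
proof -
  have fin: "finite I" "finite J" using ip_pair_finite[OF assms] by auto
  have 1: "card J = card (J - I) + card (J \<inter> I)"
    using fin by (metis Diff_Diff_Int Diff_disjoint Int_Diff_Un Un_commute card_Un_disjoint finite_Diff finite_Int inf_commute Int_Diff)
  have 2: "card (J \<inter> I) \<le> card I" using fin by (simp add: card_mono)
  show "2 \<le> card (J - I)" using 1 2 assms by (simp add: ip_pair_def)
  assume "card (J - I) = 2"
  then have "card (J \<inter> I) = card I" using 1 2 assms by (simp add: ip_pair_def)
  then show "I \<subseteq> J" using fin by (metis Int_lower2 card_subset_eq inf.absorb_iff2)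
qed

text \<open>Both terms are the same monomial with opposite signs, so the polynomial is 0 while
  \<open>pos_rel\<close> holds. Thus \<open>pos_rel\<close> can be stated uniformly for all pairs,
  and the induction on \<open>J - I\<close> has its base.\<close>

lemma pos_rel_degenerate:
  assumes "ip_pair n I J" "card (J - I) = 2"
  shows "pos_rel y I J"
proof -
  have sub: "I \<subseteq> J" using ip_pair_card_Diff(2)[OF assms] .
  have fin: "finite I" using ip_pair_finite[OF assms(1)] by auto
  obtain p q where pq: "J - I = {p, q}" "p \<noteq> q" using assms(2) by (auto simp: card_2_iff)
  have J: "J = I \<union> {p, q}" "p \<notin> I" "q \<notin> I" using pq sub by auto
  have [simp]: "{k. (k = p \<or> k = q) \<and> k < p} = (if q < p then {q} else {})"
     "{k. (k = p \<or> k = q) \<and> k < q} = (if p < q then {p} else {})" by auto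
  have "even_sign p I J \<longleftrightarrow> even (card I + card {k\<in>{p,q}. k < p})"
    "even_sign q I J \<longleftrightarrow> even (card I + card {k\<in>{p,q}. k < q})"
    using even_sign_common_part[of I "{}" "{p, q}"] fin J by auto
  then have s: "even_sign p I J \<noteq> even_sign q I J" using pq(2) by auto
  have "insert p I = J - {q}" "insert q I = J - {p}" using J pq(2) by auto
  then have "y (insert p I) + y (J - {p}) = y (insert q I) + y (J - {q})" by (simp add: add.commute)
  then show ?thesis using s pq unfolding pos_rel_def by auto
qed

lemma min_eqI_three_terms:
  fixes A B C :: ereal
  assumes "B < \<infinity> \<Longrightarrow> A \<le> B \<or> C \<le> B" "A < \<infinity> \<Longrightarrow> B \<le> A" "C < \<infinity> \<Longrightarrow> B \<le> C"
  shows "B = min A C"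
  using assms by (cases "B < \<infinity>"; cases "A < \<infinity>"; cases "C < \<infinity>") (auto simp: min_def)

text \<open>The sign of \<open>q\<close> is isolated: each outer term can be dominated only by
  \<open>q\<close>, and \<open>q\<close> only by an outer term. With infinite values included this
  is an equation rather than a pair of inequalities.\<close>

lemma pos_rel_three_terms:
  assumes "pos_rel y I J" "J - I = {p, q, r}"
    "even_sign p I J \<noteq> even_sign q I J" "even_sign r I J \<noteq> even_sign q I J"
  shows "y (insert q I) + y (J - {q}) =
    min (y (insert p I) + y (J - {p})) (y (insert r I) + y (J - {r}))"
proof (rule min_eqI_three_terms)
  let ?f = "\<lambda>k. y (insert k I) + y (J - {k})"
  have R: "?f j < \<infinity> \<Longrightarrow> \<exists>k\<in>{p,q,r}. even_sign k I J \<noteq> even_sign j I J \<and> ?f k \<le> ?f j"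
    if "j \<in> {p,q,r}" for j using assms(1) that unfolding pos_rel_def assms(2) by blast
  show "?f q < \<infinity> \<Longrightarrow> ?f p \<le> ?f q \<or> ?f r \<le> ?f q" using R[of q] assms(3,4) by auto
  show "?f p < \<infinity> \<Longrightarrow> ?f q \<le> ?f p" using R[of p] assms(3,4) by auto
  show "?f r < \<infinity> \<Longrightarrow> ?f q \<le> ?f r" using R[of r] assms(3,4) by auto
qed

lemma flag_matroid_exchange:
  assumes "forms_flag_matroid n S" "X \<in> S" "Y \<in> S" "card X = k" "card Y = k" "k \<in> {1..n-1}"
    "x \<in> X" "x \<notin> Y"
  obtains z where "z \<in> Y" "z \<notin> X" "insert z (X - {x}) \<in> S"
proof -
  have "matroid_bases {1..n} {I\<in>S. card I = k}"
    using assms(1,6) by (simp add: forms_flag_matroid_def)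
  then have "\<exists>z\<in>Y - X. insert z (X - {x}) \<in> {I\<in>S. card I = k}"
    using assms unfolding matroid_bases_def by blast
  then show ?thesis using that by auto
qed

lemma flag_matroid_sub:
  assumes "forms_flag_matroid n S" "Y \<in> S" "card Y = k" "k \<in> {1..n-1}" "j \<in> {1..n-1}" "j \<le> k"
  obtains X where "X \<in> S" "card X = j" "X \<subseteq> Y"
proof (cases "j = k")
  case False
  then have "j < k" using assms(6) by simp
  then have "\<forall>Y\<in>{I\<in>S. card I = k}. \<exists>X\<in>{I\<in>S. card I = j}. X \<subseteq> Y"
    using assms(1,4,5) unfolding forms_flag_matroid_def by blast
  then show ?thesis using that assms(2,3) by blast
qed (use assms that in auto)

lemma flag_matroid_super:
  assumes "forms_flag_matroid n S" "X \<in> S" "card X = j" "k \<in> {1..n-1}" "j \<in> {1..n-1}" "j < k"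
  obtains Y where "Y \<in> S" "card Y = k" "X \<subseteq> Y"
proof -
  have "\<forall>X\<in>{I\<in>S. card I = j}. \<exists>Y\<in>{I\<in>S. card I = k}. X \<subseteq> Y"
    using assms(1,4,5,6) unfolding forms_flag_matroid_def by blast
  then show ?thesis using that assms(2,3) by blast
qed

text \<open>From four elements of \<open>J - I\<close> on, \<open>sign_exchange\<close> applies. The
  shorter relation is the one for \<open>insert v A\<close> and J, since
  \<open>J - insert v A\<close> is \<open>J - I\<close> without \<open>v\<close>; the flag matroid
  supplies the finite pivot.\<close>

lemma pos_rel_of_three_terms:
  assumes ninf: "\<And>X. y X \<noteq> -\<infinity>"
    and three: "\<And>I J. ip_pair n I J \<Longrightarrow> card (J - I) = 3 \<Longrightarrow> pos_rel y I J"
    and fm: "forms_flag_matroid n (supp y)"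
    and pair: "ip_pair n I J"
  shows "pos_rel y I J"
  using pair
proof (induction "card (J - I)" arbitrary: I rule: less_induct)
  case less
  note pair = less.prems
  have fin: "finite I" "finite J" and sub: "I \<subseteq> {1..n}" "J \<subseteq> {1..n}" and cIJ: "card I + 2 \<le> card J"
    using ip_pair_finite[OF pair] pair by (auto simp: ip_pair_def)
  have cJ: "card J \<le> n" using card_mono[OF _ sub(2)] by simp
  consider "card (J - I) = 2" | "card (J - I) = 3" | "4 \<le> card (J - I)"
    using ip_pair_card_Diff(1)[OF pair] by linarith
  then show ?case
  proof cases
    case 1
    then show ?thesis using pos_rel_degenerate[OF pair] by simp
  next
    case 2
    then show ?thesis using three[OF pair] by simp
  next
    case 3
    (* u = 0 encodes the incidence step I \<subseteq> J, in which I grows by one element;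
       otherwise an element of I - J is traded. In both cases the three-term relations single
       out the middle element once the line is cut open at u. *)
    define u where "u = (if I \<subseteq> J then 0 else SOME u. u \<in> I - J)"
    have u: "(u = 0 \<and> I \<subseteq> J) \<or> (u \<in> I \<and> u \<notin> J)"
    proof (cases "I \<subseteq> J")
      case False
      then have "\<exists>u. u \<in> I - J" by auto
      from someI_ex[OF this] show ?thesis using False by (auto simp: u_def)
    qed (auto simp: u_def)
    have "0 \<notin> I" "0 \<notin> J" using sub by auto
    then have uJ: "u \<notin> J" using u by auto
    define A where "A = I - {u}"
    have finA: "finite A" using fin by (simp add: A_def)
    define U where "U = (if u = 0 then {} else {u})"
    have IU: "I = A \<union> U" "A \<inter> U = {}" "finite U" using u \<open>0 \<notin> I\<close> by (auto simp: A_def U_def)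
    have cA: "card I = card A + card U" using IU finA by (simp add: card_Un_disjoint)
    have cU: "card U \<le> 1" by (simp add: U_def)
    define S where "S = J - I"
    \<comment> \<open>The cyclic order starting right after \<open>u\<close>: elements below
      \<open>u\<close> are moved past all others by adding n. For \<open>u = 0\<close> it is the
      usual order.\<close>
    define \<rho> where "\<rho> k = (if u < k then k else k + n)" for k
    define a where "a k = y (insert k I)" for k
    define b where "b k = y (J - {k})" for k
    define g where "g k l = y (insert k (insert l A))" for k l
    have finS: "finite S" using fin by (simp add: S_def)
    have Sn: "x \<in> {1..n}" "x \<notin> I" "x \<notin> A" "x \<noteq> u" "x \<in> J" if "x \<in> S" for x
      using that sub uJ by (auto simp: S_def A_def)
    have inj: "inj_on \<rho> S"
    proof (rule inj_onI)
      fix x x' assume "x \<in> S" "x' \<in> S" "\<rho> x = \<rho> x'"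
      then show "x = x'" using Sn(1)[of x] Sn(1)[of x'] by (simp add: \<rho>_def split: if_splits)
    qed
    have ord: "even_sign k (insert v A) J = even_sign j (insert v A) J \<longleftrightarrow>
        ((even_sign k I J \<noteq> (\<rho> k < \<rho> v)) = (even_sign j I J \<noteq> (\<rho> j < \<rho> v)))"
      if kjv: "k \<in> S" "j \<in> S" "v \<in> S" "k \<noteq> v" "j \<noteq> v" for k j v
    proof -
      \<comment> \<open>Trading \<open>u\<close> for \<open>v\<close> changes the count above
        \<open>k\<close> by the parity of \<open>k < u\<close> plus \<open>k < v\<close>. In the cut
        order this is \<open>\<rho> k < \<rho> v\<close> up to \<open>v < u\<close>, which does not
        involve \<open>k\<close> and cancels when two terms are compared.\<close>
      have *: "even_sign k (insert v A) J = (even_sign k I J \<noteq> ((\<rho> k < \<rho> v) \<noteq> (v < u)))"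
        if k: "k \<in> S" "k \<noteq> v" for k
      proof -
        have 1: "card {i \<in> insert v A. k < i} = card {i\<in>A. k < i} + (if k < v then 1 else 0)"
          using card_Collect_insert[OF finA] Sn(3)[OF kjv(3)] by auto
        have "{i\<in>U. k < i} = (if k < u then {u} else {})" using u by (auto simp: U_def)
        then have 2: "card {i \<in> I. k < i} = card {i\<in>A. k < i} + (if k < u then 1 else 0)"
          unfolding IU(1) using card_Collect_Un[OF finA IU(3,2)] by simp
        have "\<rho> k < \<rho> v \<longleftrightarrow> (if u < k then u < v \<longrightarrow> k < v else \<not> u < v \<and> k < v)"
          using Sn(1)[OF k(1)] Sn(1)[OF kjv(3)] by (auto simp: \<rho>_def)
        then show ?thesis unfolding even_sign_def 1 2
          using k(2) Sn(4)[OF k(1)] Sn(4)[OF kjv(3)] by (auto split: if_splits)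
      qed
      show ?thesis using *[OF kjv(1,4)] *[OF kjv(2,5)] by auto
    qed
    show ?thesis unfolding pos_rel_def
    proof (intro ballI impI)
      fix j0 assume j0: "j0 \<in> J - I" "y (insert j0 I) + y (J - {j0}) < \<infinity>"
      have "\<exists>k\<in>S. even_sign k I J \<noteq> even_sign j0 I J \<and> a k + b k \<le> a j0 + b j0"
      proof (rule sign_exchange[where g = g and \<rho> = \<rho> and S = S])
        show "finite S" "inj_on \<rho> S" by fact+
        show "a x \<noteq> -\<infinity>" "b x \<noteq> -\<infinity>" "g x x' \<noteq> -\<infinity>" for x x' by (simp_all add: a_def b_def g_def ninf)
        show "g x x' = g x' x" for x x' by (simp add: g_def insert_commute)
        show "j0 \<in> S" "a j0 + b j0 < \<infinity>" using j0 by (auto simp: S_def a_def b_def)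
      next
        fix p q r assume pqr: "p \<in> S" "q \<in> S" "r \<in> S" "\<rho> p < \<rho> q" "\<rho> q < \<rho> r"
        then have d: "p \<noteq> q" "q \<noteq> r" "p \<noteq> r" by auto
        \<comment> \<open>The three-term relation for I and \<open>J3\<close>: removing one of
          \<open>p\<close>, \<open>q\<close>, \<open>r\<close> from \<open>J3\<close> leaves exactly
          the argument of \<open>g\<close> at the other two.\<close>
        define J3 where "J3 = A \<union> {p, q, r}"
        have dis: "A \<inter> {p, q, r} = {}" using Sn pqr by auto
        have c3: "card J3 = card A + 3" unfolding J3_def using finA dis d by (subst card_Un_disjoint) auto
        have diff: "J3 - I = {p, q, r}" using Sn pqr by (auto simp: J3_def A_def)
        have pr: "ip_pair n I J3" using c3 cA cU sub pqr Sn by (auto simp: ip_pair_def J3_def A_def)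
        have s: "even_sign x I J3 \<longleftrightarrow> even (card A + card {k\<in>{p,q,r}. k < x} + card {i\<in>U. x < i})"
          if "x \<in> {p,q,r}" for x
          unfolding J3_def IU(1) using that dis by (intro even_sign_common_part finA IU) auto
        have U': "card {i\<in>U. x < i} = (if x < u then 1 else 0)" for x
        proof -
          have "{i\<in>U. x < i} = (if x < u then {u} else {})" using u by (auto simp: U_def)
          then show ?thesis by simp
        qed
        have W: "card {k\<in>{p,q,r}. k < x} = (if p < x then 1 else 0) + (if q < x then 1 else 0) + (if r < x then 1 else 0)" for x
          using d by (intro card_Collect_three) auto
        have ne: "p \<noteq> u" "q \<noteq> u" "r \<noteq> u" using Sn pqr by auto
        have le: "1 \<le> p" "p \<le> n" "1 \<le> q" "q \<le> n" "1 \<le> r" "r \<le> n" using Sn(1) pqr by auto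
        have "even_sign p I J3 \<noteq> even_sign q I J3" "even_sign r I J3 \<noteq> even_sign q I J3"
          using pqr(4,5) ne le d s[unfolded W U', of p] s[unfolded W U', of q] s[unfolded W U', of r]
          by (auto simp: \<rho>_def split: if_splits)
        from pos_rel_three_terms[OF three[OF pr] diff this]
        have "y (insert q I) + y (J3 - {q}) =
          min (y (insert p I) + y (J3 - {p})) (y (insert r I) + y (J3 - {r}))" using diff d by simp
        moreover have "J3 - {q} = insert p (insert r A)" "J3 - {p} = insert q (insert r A)"
          "J3 - {r} = insert p (insert q A)" using d dis by (auto simp: J3_def)
        ultimately show "a q + g p r = min (a p + g q r) (a r + g p q)" by (simp add: a_def g_def)
      next
        fix v j assume vj: "v \<in> S" "j \<in> S" "j \<noteq> v" "b j + g v j < \<infinity>"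
        have diff: "J - insert v A = S - {v}" using uJ by (auto simp: S_def A_def)
        have "card (S - {v}) < card S" using finS vj(1) by (rule card_Diff1_less)
        moreover have cv: "card (insert v A) = Suc (card A)" using finA Sn(3)[OF vj(1)] by simp
        moreover have "card (insert v A) + 2 \<le> card J"
        proof (cases "u = 0")
          case True
          then have IJ: "I \<subseteq> J" using u \<open>0 \<notin> I\<close> by auto
          then have "card J = card I + card (J - I)" using fin by (metis card_Diff_subset card_mono le_add_diff_inverse)
          then show ?thesis using 3 cv cA by simp
        next
          case False
          then show ?thesis using cv cA cIJ by (simp add: U_def)
        qed
        ultimately have "pos_rel y (insert v A) J"
          using less.hyps[of "insert v A"] diff vj sub Sn(1)[OF vj(1)] by (auto simp: ip_pair_def S_def A_def)
        then have "\<exists>k\<in>S - {v}. even_sign k (insert v A) J \<noteq> even_sign j (insert v A) J \<and>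
           y (insert k (insert v A)) + y (J - {k}) \<le> y (insert j (insert v A)) + y (J - {j})"
          using vj unfolding pos_rel_def diff by (auto simp: g_def b_def add.commute insert_commute)
        then show "\<exists>k\<in>S - {v}. (even_sign k I J = even_sign j I J \<longleftrightarrow> (\<rho> k < \<rho> v) \<noteq> (\<rho> j < \<rho> v)) \<and>
            b k + g v k \<le> b j + g v j"
          using ord[OF _ vj(2,1) _ vj(3)] by (auto simp: g_def b_def add.commute insert_commute)
      next
        fix j assume j: "j \<in> S" "a j + b j < \<infinity>"
        have fin1: "y (insert j I) \<noteq> \<infinity>" "y (J - {j}) \<noteq> \<infinity>" using j(2) by (auto simp: a_def b_def)
        then have mem: "insert j I \<in> supp y" "J - {j} \<in> supp y" by (auto simp: supp_def)
        have cj: "card (insert j I) = Suc (card I)" "card (J - {j}) = card J - 1"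
          using fin j Sn(2,5)[OF j(1)] by auto
        \<comment> \<open>A basis inside \<open>J - {j}\<close> of the right rank pulls a basis
          towards J. If an element \<open>u\<close> is traded, exchanging it out of
          \<open>insert j I\<close> gives the pivot. If I grows, \<open>insert j I\<close> is
          enlarged by some \<open>x\<close>, and an \<open>x\<close> outside J is exchanged in the
          same way.\<close>
        show "\<exists>v\<in>S - {j}. g j v < \<infinity>"
        proof (cases "u = 0")
          case True
          then have IJ: "I \<subseteq> J" "A = I" using u \<open>0 \<notin> I\<close> by (auto simp: A_def)
          have cI: "card J = card I + card (J - I)" using IJ fin by (metis card_Diff_subset card_mono le_add_diff_inverse)
          then have r: "Suc (Suc (card I)) \<in> {1..n-1}" "Suc (card I) \<in> {1..n-1}" "card J - 1 \<in> {1..n-1}"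
            "Suc (Suc (card I)) \<le> card J - 1" using 3 cJ by auto
          obtain X where X: "X \<in> supp y" "card X = Suc (Suc (card I))" "insert j I \<subseteq> X"
            using flag_matroid_super[OF fm mem(1) cj(1) r(1,2)] by auto
          have finX: "finite X" using X(2) by (metis card.infinite nat.distinct(1))
          have "card (X - insert j I) = 1" using X cj(1) fin finX by (simp add: card_Diff_subset)
          then obtain x where x: "X - insert j I = {x}" by (auto simp: card_1_singleton_iff)
          then have Xeq: "X = insert x (insert j I)" "x \<notin> insert j I" using X(3) by auto
          obtain v where v: "v \<in> J - {j}" "v \<notin> I" "insert v (insert j I) \<in> supp y"
          proof (cases "x \<in> J")
            case True
            then show ?thesis using that[of x] Xeq X(1) by auto
          next
            case False
            obtain B where B: "B \<in> supp y" "card B = Suc (Suc (card I))" "B \<subseteq> J - {j}"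
              using flag_matroid_sub[OF fm mem(2) cj(2) r(3,1,4)] by auto
            have "x \<in> X" "x \<notin> B" using Xeq B False by auto
            from flag_matroid_exchange[OF fm X(1) B(1) X(2) B(2) r(1) this]
            obtain z where z: "z \<in> B" "z \<notin> X" "insert z (X - {x}) \<in> supp y" by auto
            have "X - {x} = insert j I" using Xeq by auto
            then show ?thesis using that[of z] z B Xeq by auto
          qed
          then have "v \<in> S - {j}" "g j v < \<infinity>"
            using IJ(2) by (auto simp: S_def g_def supp_def insert_commute)
          then show ?thesis by blast
        next
          case False
          then have uI: "u \<in> I" using u by auto
          have r: "Suc (card I) \<in> {1..n-1}" "card J - 1 \<in> {1..n-1}" "Suc (card I) \<le> card J - 1"
            using cIJ cJ by auto
          obtain B where B: "B \<in> supp y" "card B = Suc (card I)" "B \<subseteq> J - {j}"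
            using flag_matroid_sub[OF fm mem(2) cj(2) r(2,1,3)] by auto
          have "u \<in> insert j I" "u \<notin> B" using uI B uJ by auto
          from flag_matroid_exchange[OF fm mem(1) B(1) cj(1) B(2) r(1) this]
          obtain z where z: "z \<in> B" "z \<notin> insert j I" "insert z (insert j I - {u}) \<in> supp y" by auto
          have "insert j I - {u} = insert j A" using Sn(4)[OF j(1)] by (auto simp: A_def)
          then have "z \<in> S - {j}" "g j z < \<infinity>"
            using z B by (auto simp: S_def g_def supp_def insert_commute)
          then show ?thesis by blast
        qed
      qed
      then show "\<exists>k\<in>J - I. even_sign k I J \<noteq> even_sign j0 I J \<and>
          y (insert k I) + y (J - {k}) \<le> y (insert j0 I) + y (J - {j0})"
        by (simp add: S_def a_def b_def)
    qed
  qed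
qed


section \<open>Elementary column operations\<close>

definition swap_in :: "nat \<Rightarrow> nat \<Rightarrow> nat set \<Rightarrow> nat set" where
  "swap_in p q X = insert p (X - {q})"

(* the tropicalization of the elementary column operation e_q := e_q + t^c e_p *)
definition elem_op :: "nat \<Rightarrow> nat \<Rightarrow> ereal \<Rightarrow> (nat set \<Rightarrow> ereal) \<Rightarrow> nat set \<Rightarrow> ereal" where
  "elem_op p q c y X = (if q \<in> X \<and> p \<notin> X then min (y X) (c + y (swap_in p q X)) else y X)"

lemma elem_op_le: "elem_op p q c y X \<le> y X"
  by (simp add: elem_op_def)

lemma elem_op_le_swap: "q \<in> X \<Longrightarrow> p \<notin> X \<Longrightarrow> elem_op p q c y X \<le> c + y (swap_in p q X)"
  by (simp add: elem_op_def)

lemma elem_op_cases: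
  obtains "elem_op p q c y X = y X"
  | "q \<in> X" "p \<notin> X" "elem_op p q c y X = c + y (swap_in p q X)"
  by (cases "q \<in> X \<and> p \<notin> X"; cases "y X \<le> c + y (swap_in p q X)") (auto simp: elem_op_def min_def)

lemma elem_op_not_MInf:
  "(\<And>X. y X \<noteq> -\<infinity>) \<Longrightarrow> elem_op p q (ereal c) y X \<noteq> -\<infinity>"
  by (rule elem_op_cases[of p q "ereal c" y X]) auto

text \<open>No integer lies strictly between \<open>p\<close> and \<open>q\<close>, so only their
  relative position matters. The first two parts say that all other terms keep their sign. The last
  four compare the signs with which the product of \<open>insert p I\<close> and
  \<open>J - {q}\<close> arises from different terms; it is the only product shared between the
  swapped relations.\<close>

lemma even_sign_swap:
  fixes p q :: nat
  assumes adj: "p = Suc q \<or> q = Suc p" and fin: "finite I" "finite J"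
  shows "q \<in> I \<Longrightarrow> p \<notin> I \<Longrightarrow> k \<noteq> p \<Longrightarrow> k \<noteq> q \<Longrightarrow> even_sign k (swap_in p q I) J = even_sign k I J"
    and "q \<in> J \<Longrightarrow> p \<notin> J \<Longrightarrow> k \<noteq> p \<Longrightarrow> k \<noteq> q \<Longrightarrow> even_sign k I (swap_in p q J) = even_sign k I J"
    and "q \<in> I \<Longrightarrow> p \<notin> I \<Longrightarrow> p \<in> J \<Longrightarrow> q \<in> J \<Longrightarrow> even_sign q (swap_in p q I) J = even_sign p I J"
    and "q \<in> I \<Longrightarrow> p \<notin> I \<Longrightarrow> q \<in> J \<Longrightarrow> p \<notin> J \<Longrightarrow>
      even_sign q (swap_in p q I) J \<noteq> even_sign p I (swap_in p q J)"
    and "p \<notin> I \<Longrightarrow> q \<notin> I \<Longrightarrow> p \<in> J \<Longrightarrow> q \<in> J \<Longrightarrow> even_sign p I J \<noteq> even_sign q I J"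
    and "p \<notin> I \<Longrightarrow> q \<notin> I \<Longrightarrow> q \<in> J \<Longrightarrow> p \<notin> J \<Longrightarrow> even_sign p I (swap_in p q J) = even_sign q I J"
proof -
  have pq: "p \<noteq> q" using adj by auto
  define I0 where "I0 = I - {p, q}"
  define J0 where "J0 = J - {p, q}"
  have f0: "finite I0" "finite J0" "p \<notin> I0" "q \<notin> I0" "p \<notin> J0" "q \<notin> J0"
    using fin by (auto simp: I0_def J0_def)
  have lt: "(k < p) = (k < q)" "(p < k) = (q < k)" if "k \<noteq> p" "k \<noteq> q" for k
    using adj that by auto
  have P: "{i\<in>X. p < i} = {i\<in>X. q < i}" "{i\<in>X. i < p} = {i\<in>X. i < q}" if "p \<notin> X" "q \<notin> X" for X
  proof -
    have "i \<in> X \<Longrightarrow> (p < i) = (q < i) \<and> (i < p) = (i < q)" for i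
      using lt[of i] that by metis
    then show "{i\<in>X. p < i} = {i\<in>X. q < i}" "{i\<in>X. i < p} = {i\<in>X. i < q}" by blast+
  qed
  note c1 = card_Collect_insert
  have I: "I = insert q I0" "swap_in p q I = insert p I0" if "q \<in> I" "p \<notin> I"
    using that by (auto simp: I0_def swap_in_def)
  have J: "J = insert q J0" "swap_in p q J = insert p J0" if "q \<in> J" "p \<notin> J"
    using that by (auto simp: J0_def swap_in_def)
  have I': "I = I0" if "q \<notin> I" "p \<notin> I" using that by (auto simp: I0_def)
  have J': "J = insert p (insert q J0)" if "q \<in> J" "p \<in> J" using that by (auto simp: J0_def)
  have L: "card {i \<in> insert p X. Q i} = card {i\<in>X. Q i} + (if Q p then 1 else 0)" if "finite X" "p \<notin> X" for X Q
    using c1 that .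
  have M: "card {i \<in> insert q X. Q i} = card {i\<in>X. Q i} + (if Q q then 1 else 0)" if "finite X" "q \<notin> X" for X Q
    using c1 that .
  have N: "card {i \<in> insert p (insert q J0). Q i} = card {i\<in>J0. Q i} + (if Q p then 1 else 0) + (if Q q then 1 else 0)" for Q
    using L[of "insert q J0" Q] M[of J0 Q] f0 pq by simp
  show "even_sign k (swap_in p q I) J = even_sign k I J" if "q \<in> I" "p \<notin> I" "k \<noteq> p" "k \<noteq> q"
    unfolding even_sign_def I(2)[OF that(1,2)] L[OF f0(1,3)]
    using M[OF f0(1,4)] I(1)[OF that(1,2)] lt[OF that(3,4)] by simp
  show "even_sign k I (swap_in p q J) = even_sign k I J" if "q \<in> J" "p \<notin> J" "k \<noteq> p" "k \<noteq> q"
    unfolding even_sign_def J(2)[OF that(1,2)] L[OF f0(2,5)]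
    using M[OF f0(2,6)] J(1)[OF that(1,2)] lt[OF that(3,4)] by simp
  show "even_sign q (swap_in p q I) J = even_sign p I J" if "q \<in> I" "p \<notin> I" "p \<in> J" "q \<in> J"
    unfolding even_sign_def I(2)[OF that(1,2)] L[OF f0(1,3)]
    using M[OF f0(1,4)] I(1)[OF that(1,2)] J'[OF that(4,3)] N P[OF f0(3,4)] P[OF f0(5,6)] adj by auto
  show "even_sign q (swap_in p q I) J \<noteq> even_sign p I (swap_in p q J)"
    if "q \<in> I" "p \<notin> I" "q \<in> J" "p \<notin> J"
  proof -
    have "card {k\<in>J. k < q} = card {k\<in>J0. k < q}" "card {i\<in>I. p < i} = card {i\<in>I0. q < i} + (if p < q then 1 else 0)"
      unfolding I(1)[OF that(1,2)] J(1)[OF that(3,4)] M[OF f0(1,4)] M[OF f0(2,6)] P[OF f0(3,4)] by simp_all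
    moreover have "card {k\<in>insert p J0. k < p} = card {k\<in>J0. k < q}"
      "card {i\<in>insert p I0. q < i} = card {i\<in>I0. q < i} + (if q < p then 1 else 0)"
      unfolding L[OF f0(1,3)] L[OF f0(2,5)] P[OF f0(5,6)] by simp_all
    ultimately show ?thesis
      unfolding even_sign_def I(2)[OF that(1,2)] J(2)[OF that(3,4)] using pq by auto
  qed
  show "even_sign p I J \<noteq> even_sign q I J" if "p \<notin> I" "q \<notin> I" "p \<in> J" "q \<in> J"
    unfolding even_sign_def
    using I'[OF that(2,1)] J'[OF that(4,3)] N P[OF f0(3,4)] P[OF f0(5,6)] adj by auto
  show "even_sign p I (swap_in p q J) = even_sign q I J" if "p \<notin> I" "q \<notin> I" "q \<in> J" "p \<notin> J"
    unfolding even_sign_def J(2)[OF that(3,4)] L[OF f0(2,5)]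
    using I'[OF that(2,1)] M[OF f0(2,6)] J(1)[OF that(3,4)] P[OF f0(3,4)] P[OF f0(5,6)] adj by auto
qed

lemma pos_relE:
  assumes "pos_rel y I J" "j \<in> J" "j \<notin> I" "y (insert j I) + y (J - {j}) < \<infinity>"
  obtains k where "k \<in> J" "k \<notin> I" "even_sign k I J \<noteq> even_sign j I J"
    "y (insert k I) + y (J - {k}) \<le> y (insert j I) + y (J - {j})"
  using assms unfolding pos_rel_def by blast

lemma card_swap_in: "finite X \<Longrightarrow> q \<in> X \<Longrightarrow> p \<notin> X \<Longrightarrow> card (swap_in p q X) = card X"
  unfolding swap_in_def by (subst card_insert_disjoint) (auto simp: card_Suc_Diff1 simp del: card_Diff_insert)

text \<open>For minors, substituting e_q + t^c e_p turns the relation of (I, J) into the sum of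
  those of (I, J), (s I, J), (I, s J) and (s I, s J), weighted by 1, t^c, t^c and t^(2c), as far as
  the swaps apply. The tropical proof follows each minimal term back to the summand it comes from
  and finds the opposite term there.\<close>

lemma pos_rel_elem_op:
  assumes adj: "p = Suc q \<or> q = Suc p" and pq: "p \<in> {1..n}" "q \<in> {1..n}"
    and rel: "\<And>I J. ip_pair n I J \<Longrightarrow> pos_rel y I J"
    and pair: "ip_pair n I J"
  shows "pos_rel (elem_op p q (ereal c) y) I J"
  unfolding pos_rel_def
proof (intro ballI impI)
  define w where "w = elem_op p q (ereal c) y"
  define s where "s = swap_in p q"
  fix j assume j: "j \<in> J - I" and fin: "elem_op p q (ereal c) y (insert j I) + elem_op p q (ereal c) y (J - {j}) < \<infinity>"
  let ?W = "w (insert j I) + w (J - {j})"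
  let ?G = "\<lambda>s V. \<exists>k\<in>J - I. even_sign k I J \<noteq> s \<and> w (insert k I) + w (J - {k}) \<le> V"
  have mono: "?G t V \<Longrightarrow> V \<le> V' \<Longrightarrow> ?G t V'" for t V V' by (meson order_trans)
  have neq: "p \<noteq> q" using adj by auto
  have fIJ: "finite I" "finite J" using ip_pair_finite[OF pair] by auto
  note sg = even_sign_swap[OF adj fIJ, folded s_def]
  have pI: "ip_pair n (s I) J" if "q \<in> I" "p \<notin> I"
    using pair that card_swap_in[OF fIJ(1) that] pq by (auto simp: ip_pair_def s_def swap_in_def)
  have pJ: "ip_pair n I (s J)" if "q \<in> J" "p \<notin> J"
    using pair that card_swap_in[OF fIJ(2) that] pq by (auto simp: ip_pair_def s_def swap_in_def)
  have le: "w X \<le> y X" for X by (simp add: w_def elem_op_le)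
  have leI: "w (insert k I) \<le> c + y (insert k (s I))" if "q \<in> I" "p \<notin> I" "k \<noteq> p" "k \<noteq> q" for k
  proof -
    have "swap_in p q (insert k I) = insert k (s I)" using that by (auto simp: s_def swap_in_def)
    then show ?thesis using elem_op_le_swap[of q "insert k I" p "ereal c" y] that by (simp add: w_def)
  qed
  have leJ: "w (J - {k}) \<le> c + y (s J - {k})" if "q \<in> J" "p \<notin> J" "k \<noteq> p" "k \<noteq> q" for k
  proof -
    have "swap_in p q (J - {k}) = s J - {k}" using that by (auto simp: s_def swap_in_def)
    then show ?thesis using elem_op_le_swap[of q "J - {k}" p "ereal c" y] that by (simp add: w_def)
  qed
  have leIq: "w (insert q I) \<le> c + y (insert p I)" if "q \<notin> I" "p \<notin> I"
  proof -
    have "swap_in p q (insert q I) = insert p I" using that by (auto simp: s_def swap_in_def)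
    then show ?thesis using elem_op_le_swap[of q "insert q I" p "ereal c" y] that neq by (simp add: w_def)
  qed
  have leJp: "w (J - {p}) \<le> c + y (J - {q})" if "q \<in> J" "p \<in> J"
  proof -
    have "swap_in p q (J - {p}) = J - {q}" using that neq by (auto simp: s_def swap_in_def)
    then show ?thesis using elem_op_le_swap[of q "J - {p}" p "ereal c" y] that neq by (simp add: w_def)
  qed
  have inI: "insert q (s I) = insert p I" if "q \<in> I" using that by (auto simp: s_def swap_in_def)
  have inJ: "s J - {p} = J - {q}" if "p \<notin> J" using that by (auto simp: s_def swap_in_def)
  define A where "A = y (insert p I) + y (J - {q})"
  (* E1 and E2 eliminate the monomial A, which occurs with opposite signs in the two relations
     obtained by substituting p for q in J and in I. *)
  have E1: "?G (even_sign p I (s J)) (c + A)" if "q \<in> J" "p \<notin> J" "p \<notin> I" "A < \<infinity>"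
  proof -
    have "p \<in> s J" by (simp add: s_def swap_in_def)
    from pos_relE[OF rel[OF pJ[OF that(1,2)]] this that(3)] that(4) inJ[OF that(2)]
    obtain k where k: "k \<in> s J" "k \<notin> I" "even_sign k I (s J) \<noteq> even_sign p I (s J)"
      "y (insert k I) + y (s J - {k}) \<le> A" by (auto simp: A_def)
    have kpq: "k \<noteq> p" "k \<noteq> q" using k neq by (auto simp: s_def swap_in_def)
    have "w (insert k I) + w (J - {k}) \<le> y (insert k I) + (c + y (s J - {k}))"
      by (intro add_mono le leJ that kpq)
    also have "\<dots> \<le> c + A" using add_left_mono[OF k(4), of "ereal c"] by (simp add: ac_simps)
    finally show ?thesis using k sg(2)[OF that(1,2) kpq] kpq by (auto simp: s_def swap_in_def)
  qed
  have E2: "?G (even_sign q (s I) J) (c + A)" if "q \<in> I" "p \<notin> I" "q \<in> J" "A < \<infinity>"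
  proof -
    have "q \<notin> s I" using neq by (simp add: s_def swap_in_def)
    from pos_relE[OF rel[OF pI[OF that(1,2)]] that(3) this] that(4) inI[OF that(1)]
    obtain k where k: "k \<in> J" "k \<notin> s I" "even_sign k (s I) J \<noteq> even_sign q (s I) J"
      "y (insert k (s I)) + y (J - {k}) \<le> A" by (auto simp: A_def)
    have kpq: "k \<noteq> p" "k \<noteq> q" using k neq by (auto simp: s_def swap_in_def)
    have "w (insert k I) + w (J - {k}) \<le> (c + y (insert k (s I))) + y (J - {k})"
      by (intro add_mono le leI that kpq)
    also have "\<dots> \<le> c + A" using add_left_mono[OF k(4), of "ereal c"] by (simp add: ac_simps)
    finally show ?thesis using k sg(1)[OF that(1,2) kpq] kpq by (auto simp: s_def swap_in_def)
  qed
  \<comment> \<open>When \<open>p\<close> is in J, or neither \<open>p\<close> nor \<open>q\<close>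
    is in I, the product \<open>A\<close> is not eliminated: it is the shifted contribution of the
    term of \<open>p\<close> or of \<open>q\<close> in the relation itself.\<close>
  have P: "w (insert p I) + w (J - {p}) \<le> c + A" if "q \<in> J" "p \<in> J"
    using add_mono[OF le[of "insert p I"] leJp[OF that]] by (simp add: A_def ac_simps)
  have Q: "w (insert q I) + w (J - {q}) \<le> c + A" if "q \<notin> I" "p \<notin> I"
    using add_mono[OF leIq[OF that] le[of "J - {q}"]] by (simp add: A_def ac_simps)
  have jj: "j \<in> J" "j \<notin> I" using j by auto
  have finW: "?W < \<infinity>" using fin by (simp add: w_def)
  \<comment> \<open>Four cases, by which argument of the minimum is attained in each of the two
    factors; each refers to the relation of the correspondingly swapped pair.\<close>
  have "?G (even_sign j I J) ?W"
  proof (cases rule: elem_op_cases[of p q "ereal c" y "insert j I", folded w_def s_def])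
    case 1
    note i = this
    show ?thesis
    proof (cases rule: elem_op_cases[of p q "ereal c" y "J - {j}", folded w_def s_def])
      case 1
      have W: "?W = y (insert j I) + y (J - {j})" using i 1 by simp
      from pos_relE[OF rel[OF pair] jj] finW W obtain k where k: "k \<in> J" "k \<notin> I"
        "even_sign k I J \<noteq> even_sign j I J" "y (insert k I) + y (J - {k}) \<le> ?W" by auto
      have "w (insert k I) + w (J - {k}) \<le> ?W" using add_mono[OF le le] k(4) by (rule order_trans)
      then show ?thesis using k by auto
    next
      case 2
      have W: "?W = c + (y (insert j I) + y (s (J - {j})))" using i 2 by (simp add: ac_simps)
      show ?thesis
      proof (cases "p \<in> J")
        case False
        have mv: "q \<in> J" "p \<notin> J" using 2 False by auto
        have jpq: "j \<noteq> p" "j \<noteq> q" using jj 2 False by auto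
        have sJ: "s (J - {j}) = s J - {j}" using jpq by (auto simp: s_def swap_in_def)
        have "j \<in> s J" using jj jpq by (auto simp: s_def swap_in_def)
        from pos_relE[OF rel[OF pJ[OF mv]] this jj(2)] finW W sJ
        obtain k where k: "k \<in> s J" "k \<notin> I" "even_sign k I (s J) \<noteq> even_sign j I (s J)"
          "y (insert k I) + y (s J - {k}) \<le> y (insert j I) + y (s J - {j})" by auto
        have sj: "even_sign j I (s J) = even_sign j I J" using sg(2)[OF mv jpq] .
        have kW: "c + (y (insert k I) + y (s J - {k})) \<le> ?W"
          unfolding W sJ using k(4) by (rule add_left_mono)
        show ?thesis
        proof (cases "k = p")
          case False
          have kpq: "k \<noteq> p" "k \<noteq> q" using k False neq by (auto simp: s_def swap_in_def)
          have "w (insert k I) + w (J - {k}) \<le> y (insert k I) + (c + y (s J - {k}))"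
            by (intro add_mono le leJ mv kpq)
          also have "\<dots> \<le> ?W" using kW by (simp add: ac_simps)
          finally show ?thesis using k sg(2)[OF mv kpq] kpq sj by (auto simp: s_def swap_in_def)
        next
          case True
          then have AW: "c + A \<le> ?W" "p \<notin> I" using kW inJ[OF mv(2)] k(2) by (auto simp: A_def)
          have Afin: "A < \<infinity>" using AW(1) finW by (cases A) auto
          show ?thesis
          proof (cases "q \<in> I")
            case True
            have "even_sign q (s I) J = even_sign j I J"
              using sg(4)[OF True AW(2) mv] k(3) \<open>k = p\<close> sj by auto
            with mono[OF E2[OF True AW(2) mv(1) Afin] AW(1)] show ?thesis by simp
          next
            case False
            then show ?thesis using order_trans[OF Q[OF False AW(2)] AW(1)] mv k(3) \<open>k = p\<close> sj
              sg(6)[OF AW(2) False mv] by auto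
          qed
        qed
      next
        case True
        \<comment> \<open>\<open>p\<close> belongs to J but not to \<open>J - {j}\<close>, so
          \<open>j\<close> is \<open>p\<close> and the shifted term is the product \<open>A\<close>
          itself. There is no swapped J here.\<close>
        have jp: "j = p" "q \<in> J" using 2 True by auto
        have "s (J - {p}) = J - {q}" using True neq by (auto simp: s_def swap_in_def)
        then have WA: "?W = c + A" using W unfolding A_def jp(1) by simp
        have Afin: "A < \<infinity>" using WA finW by (cases A) auto
        have pI': "p \<notin> I" using jj jp by auto
        show ?thesis
        proof (cases "q \<in> I")
          case True
          from E2[OF True pI' jp(2) Afin] show ?thesis
            using sg(3)[OF True pI' \<open>p \<in> J\<close> jp(2)] jp WA by auto
        next
          case False
          then show ?thesis using Q[OF False pI'] WA jp sg(5)[OF pI' False \<open>p \<in> J\<close> jp(2)] by auto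
        qed
      qed
    qed
  next
    case 2
    note i = this
    have pI': "p \<notin> I" "j \<noteq> p" using i by auto
    show ?thesis
    proof (cases rule: elem_op_cases[of p q "ereal c" y "J - {j}", folded w_def s_def])
      case 1
      have W: "?W = c + (y (s (insert j I)) + y (J - {j}))" using i 1 by (simp add: ac_simps)
      show ?thesis
      proof (cases "q \<in> I")
        case True
        note mv = True pI'(1)
        have jpq: "j \<noteq> p" "j \<noteq> q" using jj mv pI' by auto
        have sI: "s (insert j I) = insert j (s I)" using jpq by (auto simp: s_def swap_in_def)
        have "j \<notin> s I" using jj jpq by (auto simp: s_def swap_in_def)
        from pos_relE[OF rel[OF pI[OF mv]] jj(1) this] finW W sI
        obtain k where k: "k \<in> J" "k \<notin> s I" "even_sign k (s I) J \<noteq> even_sign j (s I) J"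
          "y (insert k (s I)) + y (J - {k}) \<le> y (insert j (s I)) + y (J - {j})" by auto
        have sj: "even_sign j (s I) J = even_sign j I J" using sg(1)[OF mv jpq] .
        have kW: "c + (y (insert k (s I)) + y (J - {k})) \<le> ?W"
          unfolding W sI using k(4) by (rule add_left_mono)
        show ?thesis
        proof (cases "k = q")
          case False
          have kpq: "k \<noteq> p" "k \<noteq> q" using k False neq by (auto simp: s_def swap_in_def)
          have "w (insert k I) + w (J - {k}) \<le> (c + y (insert k (s I))) + y (J - {k})"
            by (intro add_mono le leI mv kpq)
          also have "\<dots> \<le> ?W" using kW by (simp add: ac_simps)
          finally show ?thesis using k sg(1)[OF mv kpq] kpq sj by (auto simp: s_def swap_in_def)
        next
          case True
          then have AW: "c + A \<le> ?W" "q \<in> J" using kW inI[OF mv(1)] k(1) by (auto simp: A_def)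
          have Afin: "A < \<infinity>" using AW(1) finW by (cases A) auto
          show ?thesis
          proof (cases "p \<in> J")
            case True
            then show ?thesis using order_trans[OF P[OF AW(2) True] AW(1)] mv k(3) \<open>k = q\<close> sj
              sg(3)[OF mv True AW(2)] by auto
          next
            case False
            have "even_sign p I (s J) = even_sign j I J"
              using sg(4)[OF mv AW(2) False] k(3) \<open>k = q\<close> sj by auto
            with mono[OF E1[OF AW(2) False mv(2) Afin] AW(1)] show ?thesis by simp
          qed
        qed
      next
        case False
        \<comment> \<open>The mirror image of the previous special case: \<open>q\<close> enters
          \<open>insert j I\<close> only through \<open>j\<close>, and again the shifted term is
          \<open>A\<close>.\<close>
        have jq: "j = q" using i False by auto
        have "s (insert q I) = insert p I" using False by (auto simp: s_def swap_in_def)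
        then have WA: "?W = c + A" using W unfolding A_def jq by simp
        have Afin: "A < \<infinity>" using WA finW by (cases A) auto
        show ?thesis
        proof (cases "p \<in> J")
          case True
          then show ?thesis using P[OF _ True] jj WA jq pI' sg(5)[OF pI'(1) False True] by auto
        next
          case pJ': False
          have "q \<in> J" using jj jq by simp
          from E1[OF this pJ' pI'(1) Afin] show ?thesis
            using sg(6)[OF pI'(1) False \<open>q \<in> J\<close> pJ'] jq WA by auto
        qed
      qed
    next
      case 2
      have jpq: "j \<noteq> p" "j \<noteq> q" using 2 pI' by auto
      have mI: "q \<in> I" "p \<notin> I" using i jpq by auto
      have mJ: "q \<in> J" "p \<notin> J" using 2 jpq by auto
      have sIJ: "s (insert j I) = insert j (s I)" "s (J - {j}) = s J - {j}"
        using jpq by (auto simp: s_def swap_in_def)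
      have W: "?W = (ereal c + ereal c) + (y (insert j (s I)) + y (s J - {j}))"
        unfolding i(3) 2(3) sIJ by (simp only: ac_simps)
      have js: "j \<in> s J" "j \<notin> s I" using jj jpq by (auto simp: s_def swap_in_def)
      have pr: "ip_pair n (s I) (s J)"
        using pI[OF mI] pJ[OF mJ] card_swap_in[OF fIJ(2) mJ] by (auto simp: ip_pair_def s_def)
      have "y (insert j (s I)) + y (s J - {j}) < \<infinity>"
        using finW unfolding W by (cases "y (insert j (s I)) + y (s J - {j})") auto
      from pos_relE[OF rel[OF pr] js this]
      obtain k where k: "k \<in> s J" "k \<notin> s I" "even_sign k (s I) (s J) \<noteq> even_sign j (s I) (s J)"
          "y (insert k (s I)) + y (s J - {k}) \<le> y (insert j (s I)) + y (s J - {j})" .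
      have kpq: "k \<noteq> p" "k \<noteq> q" using k neq by (auto simp: s_def swap_in_def)
      have fs: "finite (s J)" using fIJ by (simp add: s_def swap_in_def)
      have ss: "even_sign l (s I) (s J) = even_sign l I J" if "l \<noteq> p" "l \<noteq> q" for l
        using even_sign_swap(1)[OF adj fIJ(1) fs mI that] sg(2)[OF mJ that] by (simp add: s_def)
      have "w (insert k I) + w (J - {k}) \<le> (c + y (insert k (s I))) + (c + y (s J - {k}))"
        by (intro add_mono leI leJ mI mJ kpq)
      also have "\<dots> = (ereal c + ereal c) + (y (insert k (s I)) + y (s J - {k}))" by (simp only: ac_simps)
      also have "\<dots> \<le> ?W" unfolding W using k(4) by (rule add_left_mono)
      finally show ?thesis using k ss[OF kpq] ss[OF jpq] kpq by (auto simp: s_def swap_in_def)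
    qed
  qed
  then show "\<exists>k\<in>J - I. even_sign k I J \<noteq> even_sign j I J \<and>
     elem_op p q (ereal c) y (insert k I) + elem_op p q (ereal c) y (J - {k})
     \<le> elem_op p q (ereal c) y (insert j I) + elem_op p q (ereal c) y (J - {j})"
    by (simp add: w_def)
qed


section \<open>Polynomials and their tropical solutions\<close>

definition mono_eval :: "(nat set \<Rightarrow> real) \<Rightarrow> (nat set \<Rightarrow>\<^sub>0 nat) \<Rightarrow> real" where
  "mono_eval P b = (\<Prod>I\<in>Poly_Mapping.keys b. P I ^ Poly_Mapping.lookup b I)"

definition poly_eval :: "(nat set \<Rightarrow> real) \<Rightarrow> mpoly \<Rightarrow> real" where
  "poly_eval P p = (\<Sum>b\<in>Poly_Mapping.keys p. Poly_Mapping.lookup p b * mono_eval P b)"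

lemma mono_eval_superset:
  assumes "finite A" "Poly_Mapping.keys b \<subseteq> A"
  shows "mono_eval P b = (\<Prod>I\<in>A. P I ^ Poly_Mapping.lookup b I)"
  unfolding mono_eval_def using assms
  by (intro prod.mono_neutral_left) (auto simp: in_keys_iff)

lemma mono_eval_add: "mono_eval P (b + c) = mono_eval P b * mono_eval P c"
proof -
  let ?A = "Poly_Mapping.keys b \<union> Poly_Mapping.keys c"
  have "mono_eval P (b + c) = (\<Prod>I\<in>?A. P I ^ Poly_Mapping.lookup (b + c) I)"
    using Poly_Mapping.keys_add[of b c] by (intro mono_eval_superset) auto
  also have "\<dots> = (\<Prod>I\<in>?A. P I ^ Poly_Mapping.lookup b I) * (\<Prod>I\<in>?A. P I ^ Poly_Mapping.lookup c I)"
    by (simp add: lookup_add power_add prod.distrib)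
  also have "\<dots> = mono_eval P b * mono_eval P c"
    using mono_eval_superset[of ?A b P] mono_eval_superset[of ?A c P] by simp
  finally show ?thesis .
qed

lemma mono_eval_single [simp]: "mono_eval P (Poly_Mapping.single I k) = P I ^ k"
  by (simp add: mono_eval_def)

lemma poly_eval_zero [simp]: "poly_eval P 0 = 0"
  by (simp add: poly_eval_def)

lemma poly_eval_single [simp]: "poly_eval P (Poly_Mapping.single m c) = c * mono_eval P m"
  by (simp add: poly_eval_def)

lemma poly_eval_add: "poly_eval P (p + q) = poly_eval P p + poly_eval P q"
  unfolding poly_eval_def
  by (rule setsum_keys_plus_distrib[where f = "\<lambda>b c. c * mono_eval P b"]) (auto simp: algebra_simps)

lemma poly_eval_sum: "poly_eval P (\<Sum>x\<in>A. f x) = (\<Sum>x\<in>A. poly_eval P (f x))"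
  by (induction A rule: infinite_finite_induct) (auto simp: poly_eval_add)

lemma poly_mapping_single_induct [case_names zero add]:
  assumes "Q 0" "\<And>m c p. Q p \<Longrightarrow> Q (Poly_Mapping.single m c + p)"
  shows "Q (p :: 'a \<Rightarrow>\<^sub>0 'b::comm_monoid_add)"
proof (induction p rule: update_induct)
  case (update f a b)
  have "Poly_Mapping.update a b f = Poly_Mapping.single a b + f"
    using update(1) by (intro poly_mapping_eqI) (auto simp: lookup_update lookup_add lookup_single in_keys_iff when_def)
  then show ?case using assms(2) update by simp
qed (use assms in auto)

lemma poly_eval_mult: "poly_eval P (p * q) = poly_eval P p * poly_eval P q"
proof (induction p rule: poly_mapping_single_induct)
  case (add m c p)
  have "poly_eval P (Poly_Mapping.single m c * q) = c * mono_eval P m * poly_eval P q"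
    by (induction q rule: poly_mapping_single_induct)
      (auto simp: poly_eval_add mult_single distrib_left mono_eval_add)
  then show ?case using add by (simp add: poly_eval_add distrib_right)
qed simp

lemma poly_eval_ideal:
  assumes "p \<in> ideal_gen G" "\<And>g. g \<in> G \<Longrightarrow> poly_eval P g = 0"
  shows "poly_eval P p = 0"
  using assms(1) by induction (auto simp: poly_eval_add poly_eval_mult assms(2))

lemma ideal_gen_superset: "G \<subseteq> ideal_gen G"
proof
  fix g assume "g \<in> G"
  from ideal_gen.step[OF this ideal_gen.zero, of 1] show "g \<in> ideal_gen G" by simp
qed

section \<open>Monomials and coefficients of the incidence polynomials\<close>

lemma ip_sign_even_sign: "ip_sign j I J = (if even_sign j I J then 1 else -1)"
  by (simp add: ip_sign_def even_sign_def)

definition ip_mono :: "nat set \<Rightarrow> nat set \<Rightarrow> nat \<Rightarrow> (nat set \<Rightarrow>\<^sub>0 nat)" where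
  "ip_mono I J j = Poly_Mapping.single (insert j I) 1 + Poly_Mapping.single (J - {j}) 1"

lemma ip_rel_singles:
  "ip_rel I J = (\<Sum>j\<in>J - I. Poly_Mapping.single (ip_mono I J j) (of_int (ip_sign j I J)))"
proof -
  have "of_int s * (Var X :: mpoly) * Var Y =
     Poly_Mapping.single (Poly_Mapping.single X 1 + Poly_Mapping.single Y 1) (of_int s)" for s X Y
    unfolding Var_def by (subst single_of_int[symmetric]) (simp only: mult_single add_0 mult_1_right)
  then show ?thesis by (simp add: ip_rel_def ip_mono_def)
qed

lemma poly_eval_ip_rel:
  "poly_eval P (ip_rel I J) = (\<Sum>j\<in>J - I. of_int (ip_sign j I J) * P (insert j I) * P (J - {j}))"
  by (simp add: ip_rel_singles poly_eval_sum ip_mono_def mono_eval_add mult.assoc)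

lemma keys_add_nat: "Poly_Mapping.keys (b + c) = Poly_Mapping.keys b \<union> Poly_Mapping.keys (c :: 'a \<Rightarrow>\<^sub>0 nat)"
  by (auto simp: in_keys_iff lookup_add)

lemma keys_ip_mono: "Poly_Mapping.keys (ip_mono I J j) = {insert j I, J - {j}}"
  by (simp add: ip_mono_def keys_add_nat insert_commute)

lemma term_val_ip_mono: "term_val y (ip_mono I J j) = y (insert j I) + y (J - {j})"
proof -
  have ne: "insert j I \<noteq> J - {j}" by auto
  then have "Poly_Mapping.lookup (ip_mono I J j) (insert j I) = 1" "Poly_Mapping.lookup (ip_mono I J j) (J - {j}) = 1"
    by (simp_all add: ip_mono_def lookup_add lookup_single_not_eq)
  then show ?thesis using ne by (simp add: term_val_def keys_ip_mono flip: one_ereal_def)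
qed

text \<open>A monomial is an unordered pair of sets. Two indices could share it only crosswise, by
  \<open>insert j I = J - {k}\<close>, and then \<open>J - I\<close> has at most the elements
  \<open>j\<close> and \<open>k\<close>. Hence with three or more elements no terms cancel.\<close>

lemma inj_on_ip_mono:
  assumes "3 \<le> card (J - I)"
  shows "inj_on (ip_mono I J) (J - I)"
proof (rule inj_onI, rule ccontr)
  fix j k assume jk: "j \<in> J - I" "k \<in> J - I" "ip_mono I J j = ip_mono I J k" "j \<noteq> k"
  then have "{insert j I, J - {j}} = {insert k I, J - {k}}"
    using keys_ip_mono[of I J j] keys_ip_mono[of I J k] by simp
  moreover have "insert j I \<noteq> insert k I" using jk by auto
  ultimately have "insert j I = J - {k}" by (auto simp: doubleton_eq_iff)
  then have "J - I \<subseteq> {j, k}" by auto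
  from card_mono[OF _ this] have "card (J - I) \<le> card {j, k}" by simp
  then show False using assms jk(4) by simp
qed

lemma ip_rel_coeffs:
  assumes "finite J" "3 \<le> card (J - I)"
  shows "Poly_Mapping.keys (ip_rel I J) = ip_mono I J ` (J - I)"
    and "j \<in> J - I \<Longrightarrow> Poly_Mapping.lookup (ip_rel I J) (ip_mono I J j) = of_int (ip_sign j I J)"
proof -
  have L: "Poly_Mapping.lookup (ip_rel I J) m = (\<Sum>j\<in>J - I. of_int (ip_sign j I J) when ip_mono I J j = m)" for m
    by (simp add: ip_rel_singles lookup_sum lookup_single)
  show 1: "Poly_Mapping.lookup (ip_rel I J) (ip_mono I J j) = of_int (ip_sign j I J)" if "j \<in> J - I" for j
  proof -
    have "(\<Sum>k\<in>J - I. of_int (ip_sign k I J) when ip_mono I J k = ip_mono I J j) =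
       (\<Sum>k\<in>J - I. if k = j then of_int (ip_sign k I J) else (0::real))"
      using inj_on_ip_mono[OF assms(2)] that by (intro sum.cong) (auto simp: when_def dest: inj_onD)
    then show ?thesis using that assms(1) by (simp add: L)
  qed
  show "Poly_Mapping.keys (ip_rel I J) = ip_mono I J ` (J - I)"
  proof
    show "Poly_Mapping.keys (ip_rel I J) \<subseteq> ip_mono I J ` (J - I)"
    proof
      fix m assume "m \<in> Poly_Mapping.keys (ip_rel I J)"
      then have "(\<Sum>j\<in>J - I. of_int (ip_sign j I J) when ip_mono I J j = m) \<noteq> (0::real)"
        by (simp add: in_keys_iff L)
      then obtain j where "j \<in> J - I" "(of_int (ip_sign j I J) when ip_mono I J j = m) \<noteq> (0::real)"
        by (meson sum.neutral)
      then show "m \<in> ip_mono I J ` (J - I)" by (auto simp: when_def split: if_splits)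
    qed
    show "ip_mono I J ` (J - I) \<subseteq> Poly_Mapping.keys (ip_rel I J)"
      using 1 by (auto simp: in_keys_iff ip_sign_def)
  qed
qed

text \<open>The overall minimum is attained with both signs, so every term is dominated by a
  minimiser of the sign opposite to its own.\<close>

lemma pos_rel_of_trop_pos_sol:
  assumes "finite J" "3 \<le> card (J - I)" "trop_pos_sol y (ip_rel I J)"
  shows "pos_rel y I J"
  unfolding pos_rel_def
proof (intro ballI impI)
  fix j assume j: "j \<in> J - I"
  let ?p = "ip_rel I J"
  note K = ip_rel_coeffs(1)[OF assms(1,2)] and L = ip_rel_coeffs(2)[OF assms(1,2)]
  have le: "min_val y ?p \<le> y (insert j I) + y (J - {j})"
    unfolding min_val_def using j assms(1) by (intro Min_le) (auto simp: K image_iff term_val_ip_mono intro!: bexI[of _ j])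
  have "\<exists>k\<in>J - I. even_sign k I J \<noteq> even_sign j I J \<and> y (insert k I) + y (J - {k}) = min_val y ?p"
  proof (cases "even_sign j I J")
    case True
    obtain b where "b \<in> Poly_Mapping.keys ?p" "term_val y b = min_val y ?p" "Poly_Mapping.lookup ?p b < 0"
      using assms(3) unfolding trop_pos_sol_def by blast
    then obtain k where "k \<in> J - I" "term_val y (ip_mono I J k) = min_val y ?p" "of_int (ip_sign k I J) < (0::real)"
      using K L by auto
    then show ?thesis using True by (auto simp: term_val_ip_mono ip_sign_even_sign split: if_splits)
  next
    case False
    obtain b where "b \<in> Poly_Mapping.keys ?p" "term_val y b = min_val y ?p" "Poly_Mapping.lookup ?p b > 0"
      using assms(3) unfolding trop_pos_sol_def by blast
    then obtain k where "k \<in> J - I" "term_val y (ip_mono I J k) = min_val y ?p" "of_int (ip_sign k I J) > (0::real)"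
      using K L by auto
    then show ?thesis using False by (auto simp: term_val_ip_mono ip_sign_even_sign split: if_splits)
  qed
  then show "\<exists>k\<in>J - I. even_sign k I J \<noteq> even_sign j I J \<and>
      y (insert k I) + y (J - {k}) \<le> y (insert j I) + y (J - {j})"
    using le by auto
qed

lemma ip_rel_nonzero:
  assumes "finite J" "3 \<le> card (J - I)"
  shows "ip_rel I J \<noteq> 0"
proof -
  have "J - I \<noteq> {}" using assms(2) by (metis card.empty not_numeral_le_zero)
  then have "Poly_Mapping.keys (ip_rel I J) \<noteq> {}" using ip_rel_coeffs(1)[OF assms] by simp
  then show ?thesis by auto
qed

section \<open>Positive solutions as a closed condition\<close>

definition pos_keys :: "mpoly \<Rightarrow> (nat set \<Rightarrow>\<^sub>0 nat) set" where
  "pos_keys p = {b \<in> Poly_Mapping.keys p. Poly_Mapping.lookup p b > 0}"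

definition neg_keys :: "mpoly \<Rightarrow> (nat set \<Rightarrow>\<^sub>0 nat) set" where
  "neg_keys p = {b \<in> Poly_Mapping.keys p. Poly_Mapping.lookup p b < 0}"

lemma finite_pos_neg_keys [simp]: "finite (pos_keys p)" "finite (neg_keys p)"
  by (simp_all add: pos_keys_def neg_keys_def)

lemma keys_eq_pos_neg: "Poly_Mapping.keys p = pos_keys p \<union> neg_keys p"
  by (auto simp: pos_keys_def neg_keys_def in_keys_iff)

text \<open>In this form being a positive solution is an equation between two continuous functions
  of the point, which passes to limits. The two distinct minimisers required by
  \<open>trop_sol\<close> are those of opposite sign.\<close>

lemma trop_pos_sol_iff:
  "trop_pos_sol y p \<longleftrightarrow> pos_keys p \<noteq> {} \<and> neg_keys p \<noteq> {} \<and>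
     Min (term_val y ` pos_keys p) = Min (term_val y ` neg_keys p)"
proof (cases "pos_keys p \<noteq> {} \<and> neg_keys p \<noteq> {}")
  case True
  have mv: "min_val y p = min (Min (term_val y ` pos_keys p)) (Min (term_val y ` neg_keys p))"
    unfolding min_val_def keys_eq_pos_neg image_Un using True by (intro Min_Un) auto
  have pos: "(\<exists>b\<in>Poly_Mapping.keys p. term_val y b = min_val y p \<and> Poly_Mapping.lookup p b > 0) \<longleftrightarrow>
      min_val y p = Min (term_val y ` pos_keys p)"
  proof
    assume "\<exists>b\<in>Poly_Mapping.keys p. term_val y b = min_val y p \<and> Poly_Mapping.lookup p b > 0"
    then obtain b where b: "b \<in> pos_keys p" "term_val y b = min_val y p" by (auto simp: pos_keys_def)
    then have "Min (term_val y ` pos_keys p) \<le> min_val y p" by (intro Min_le) (auto simp flip: b(2))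
    then show "min_val y p = Min (term_val y ` pos_keys p)" using mv by simp
  next
    assume *: "min_val y p = Min (term_val y ` pos_keys p)"
    have "Min (term_val y ` pos_keys p) \<in> term_val y ` pos_keys p" using True by (intro Min_in) auto
    then show "\<exists>b\<in>Poly_Mapping.keys p. term_val y b = min_val y p \<and> Poly_Mapping.lookup p b > 0"
      unfolding * by (auto simp: pos_keys_def)
  qed
  have neg: "(\<exists>b\<in>Poly_Mapping.keys p. term_val y b = min_val y p \<and> Poly_Mapping.lookup p b < 0) \<longleftrightarrow>
      min_val y p = Min (term_val y ` neg_keys p)"
  proof
    assume "\<exists>b\<in>Poly_Mapping.keys p. term_val y b = min_val y p \<and> Poly_Mapping.lookup p b < 0"
    then obtain b where b: "b \<in> neg_keys p" "term_val y b = min_val y p" by (auto simp: neg_keys_def)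
    then have "Min (term_val y ` neg_keys p) \<le> min_val y p" by (intro Min_le) (auto simp flip: b(2))
    then show "min_val y p = Min (term_val y ` neg_keys p)" using mv by simp
  next
    assume *: "min_val y p = Min (term_val y ` neg_keys p)"
    have "Min (term_val y ` neg_keys p) \<in> term_val y ` neg_keys p" using True by (intro Min_in) auto
    then show "\<exists>b\<in>Poly_Mapping.keys p. term_val y b = min_val y p \<and> Poly_Mapping.lookup p b < 0"
      unfolding * by (auto simp: neg_keys_def)
  qed
  have "trop_sol y p" if asm: "\<exists>b\<in>Poly_Mapping.keys p. term_val y b = min_val y p \<and> Poly_Mapping.lookup p b > 0"
     "\<exists>b\<in>Poly_Mapping.keys p. term_val y b = min_val y p \<and> Poly_Mapping.lookup p b < 0"
  proof -
    obtain b1 b2 where "b1 \<in> Poly_Mapping.keys p" "term_val y b1 = min_val y p" "Poly_Mapping.lookup p b1 > 0"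
      "b2 \<in> Poly_Mapping.keys p" "term_val y b2 = min_val y p" "Poly_Mapping.lookup p b2 < 0"
      using asm by blast
    then show ?thesis unfolding trop_sol_def by (intro bexI[of _ b1] bexI[of _ b2]) auto
  qed
  then have "trop_pos_sol y p \<longleftrightarrow> min_val y p = Min (term_val y ` pos_keys p) \<and> min_val y p = Min (term_val y ` neg_keys p)"
    unfolding trop_pos_sol_def using pos neg by blast
  also have "\<dots> \<longleftrightarrow> Min (term_val y ` pos_keys p) = Min (term_val y ` neg_keys p)" using mv by auto
  finally show ?thesis using True by simp
next
  case False
  then show ?thesis unfolding trop_pos_sol_def by (auto simp: pos_keys_def neg_keys_def)
qed

lemma sum_ereal_not_MInf:
  "(\<And>x. x \<in> A \<Longrightarrow> f x \<noteq> (-\<infinity>::ereal)) \<Longrightarrow> sum f A \<noteq> -\<infinity>"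
  by (induction A rule: infinite_finite_induct) auto

text \<open>Extended addition is discontinuous only where opposite infinities meet; excluding
  \<open>-\<infinity>\<close> as a limit avoids these points.\<close>

lemma tendsto_sum_ereal:
  fixes f :: "'a \<Rightarrow> 'b \<Rightarrow> ereal"
  assumes "finite A" "\<And>i. i \<in> A \<Longrightarrow> ((\<lambda>x. f x i) \<longlongrightarrow> l i) F" "\<And>i. i \<in> A \<Longrightarrow> l i \<noteq> -\<infinity>"
  shows "((\<lambda>x. \<Sum>i\<in>A. f x i) \<longlongrightarrow> (\<Sum>i\<in>A. l i)) F"
  using assms
proof (induction A rule: finite_induct)
  case (insert a A)
  have "sum l A \<noteq> -\<infinity>" using insert by (intro sum_ereal_not_MInf) auto
  then have "((\<lambda>x. f x a + (\<Sum>i\<in>A. f x i)) \<longlongrightarrow> l a + (\<Sum>i\<in>A. l i)) F"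
    using insert by (intro tendsto_add_ereal_general) auto
  then show ?case using insert by simp
qed simp

lemma tendsto_Min:
  fixes f :: "'a \<Rightarrow> 'b \<Rightarrow> 'c::linorder_topology"
  assumes "finite A" "A \<noteq> {}" "\<And>i. i \<in> A \<Longrightarrow> ((\<lambda>x. f x i) \<longlongrightarrow> l i) F"
  shows "((\<lambda>x. Min (f x ` A)) \<longlongrightarrow> Min (l ` A)) F"
  using assms
proof (induction A rule: finite_ne_induct)
  case (insert a A)
  then have "((\<lambda>x. min (f x a) (Min (f x ` A))) \<longlongrightarrow> min (l a) (Min (l ` A))) F"
    by (intro tendsto_min) auto
  then show ?case using insert by simp
qed simp

lemma tendsto_term_val:
  assumes "\<And>I. ((\<lambda>m. z m I) \<longlongrightarrow> y I) F" "\<And>I. y I \<noteq> -\<infinity>"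
  shows "((\<lambda>m. term_val (z m) b) \<longlongrightarrow> term_val y b) F"
  unfolding term_val_def
proof (rule tendsto_sum_ereal)
  show "((\<lambda>m. ereal (real (Poly_Mapping.lookup b i)) * z m i) \<longlongrightarrow> ereal (real (Poly_Mapping.lookup b i)) * y i) F" for i
    using assms(1) by (intro tendsto_cmult_ereal) auto
  show "ereal (real (Poly_Mapping.lookup b i)) * y i \<noteq> -\<infinity>" for i
    using assms(2)[of i] by (cases "y i") (auto simp: zero_ereal_def)
qed simp

lemma trop_pos_sol_closed:
  assumes "\<And>I. ((\<lambda>m. z m I) \<longlongrightarrow> y I) F" "\<And>I. y I \<noteq> -\<infinity>" "F \<noteq> bot"
    "\<And>m. trop_pos_sol (z m) p"
  shows "trop_pos_sol y p"
proof -
  have ne: "pos_keys p \<noteq> {}" "neg_keys p \<noteq> {}" using assms(4) by (auto simp: trop_pos_sol_iff)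
  have "((\<lambda>m. Min (term_val (z m) ` pos_keys p)) \<longlongrightarrow> Min (term_val y ` pos_keys p)) F"
    "((\<lambda>m. Min (term_val (z m) ` neg_keys p)) \<longlongrightarrow> Min (term_val y ` neg_keys p)) F"
    using ne by (auto intro!: tendsto_Min tendsto_term_val assms(1,2))
  moreover have "(\<lambda>m. Min (term_val (z m) ` pos_keys p)) = (\<lambda>m. Min (term_val (z m) ` neg_keys p))"
    using assms(4) by (auto simp: trop_pos_sol_iff)
  ultimately show ?thesis using ne tendsto_unique[OF assms(3)] by (auto simp: trop_pos_sol_iff)
qed


section \<open>Totally positive lifts of finite points\<close>

text \<open>With t = exp (-x), f behaves like t^v up to factors that are subexponential in x.
  Positivity at every x makes the logarithm laws identities of functions.\<close>

definition has_val :: "(real \<Rightarrow> real) \<Rightarrow> real \<Rightarrow> bool" where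
  "has_val f v \<longleftrightarrow> (\<forall>x. 0 < f x) \<and> ((\<lambda>x. ln (f x) / x) \<longlongrightarrow> - v) at_top"

lemma has_val_pos: "has_val f v \<Longrightarrow> 0 < f x"
  by (simp add: has_val_def)

lemma has_val_unique: "has_val f v \<Longrightarrow> has_val f w \<Longrightarrow> v = w"
  unfolding has_val_def using tendsto_unique[OF trivial_limit_at_top_linorder] by fastforce

lemma has_val_exp: "has_val (\<lambda>x. exp (- (x * v))) v"
proof -
  have "eventually (\<lambda>x::real. ln (exp (- (x * v))) / x = - v) at_top"
    using eventually_gt_at_top[of 0] by eventually_elim simp
  then show ?thesis by (simp add: has_val_def tendsto_eventually)
qed

lemma has_val_const: "0 < c \<Longrightarrow> has_val (\<lambda>x. c) 0"
  by (auto simp: has_val_def intro!: tendsto_divide_0 filterlim_ident filterlim_at_top_imp_at_infinity)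

lemma has_val_mult:
  assumes "has_val f v" "has_val g w"
  shows "has_val (\<lambda>x. f x * g x) (v + w)"
proof -
  have "(\<lambda>x. ln (f x * g x) / x) = (\<lambda>x. ln (f x) / x + ln (g x) / x)"
    using has_val_pos[OF assms(1)] has_val_pos[OF assms(2)] by (simp add: ln_mult_pos add_divide_distrib)
  moreover have "((\<lambda>x. ln (f x) / x + ln (g x) / x) \<longlongrightarrow> - v + - w) at_top"
    using assms by (intro tendsto_add) (auto simp: has_val_def)
  ultimately show ?thesis using assms by (simp add: has_val_def)
qed

lemma has_val_divide:
  assumes "has_val f v" "has_val g w"
  shows "has_val (\<lambda>x. f x / g x) (v - w)"
proof -
  have "(\<lambda>x. ln (f x / g x) / x) = (\<lambda>x. ln (f x) / x - ln (g x) / x)"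
    using has_val_pos[OF assms(1)] has_val_pos[OF assms(2)] by (simp add: ln_divide_pos diff_divide_distrib)
  moreover have "((\<lambda>x. ln (f x) / x - ln (g x) / x) \<longlongrightarrow> - v - - w) at_top"
    using assms by (intro tendsto_diff) (auto simp: has_val_def)
  ultimately show ?thesis using assms by (simp add: has_val_def)
qed

lemma has_val_power: "has_val f v \<Longrightarrow> has_val (\<lambda>x. f x ^ k) (real k * v)"
proof (induction k)
  case 0
  then show ?case using has_val_const[of 1] by simp
next
  case (Suc k)
  from has_val_mult[OF Suc.prems Suc.IH[OF Suc.prems]] show ?case by (simp add: algebra_simps)
qed

lemma has_val_prod:
  "(\<And>i. i \<in> A \<Longrightarrow> has_val (f i) (v i)) \<Longrightarrow> has_val (\<lambda>x. \<Prod>i\<in>A. f i x) (\<Sum>i\<in>A. v i)"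
  by (induction A rule: infinite_finite_induct) (auto simp: has_val_const has_val_mult)

text \<open>For positive functions nothing cancels: the sum lies between the maximum and twice the
  maximum, and the factor 2 disappears because \<open>ln 2 / x\<close> tends to 0.\<close>

lemma has_val_add:
  assumes "has_val f v" "has_val g w"
  shows "has_val (\<lambda>x. f x + g x) (min v w)"
proof -
  note pos = has_val_pos[OF assms(1)] has_val_pos[OF assms(2)]
  define L where "L x = max (ln (f x) / x) (ln (g x) / x)" for x
  have lim: "(L \<longlongrightarrow> - min v w) at_top"
  proof -
    have "(L \<longlongrightarrow> max (- v) (- w)) at_top"
      unfolding L_def using assms by (intro tendsto_max) (auto simp: has_val_def)
    then show ?thesis by (simp add: min_def max_def split: if_splits)
  qed
  have lim2: "((\<lambda>x. L x + ln 2 / x) \<longlongrightarrow> - min v w + 0) at_top"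
    by (intro tendsto_add lim tendsto_divide_0[OF tendsto_const] filterlim_ident filterlim_at_top_imp_at_infinity)
  have "((\<lambda>x. ln (f x + g x) / x) \<longlongrightarrow> - min v w) at_top"
  proof (rule tendsto_sandwich[OF _ _ lim lim2[unfolded add_0_right]])
    show "\<forall>\<^sub>F x in at_top. L x \<le> ln (f x + g x) / x"
      using eventually_gt_at_top[of 0]
    proof eventually_elim
      case (elim x)
      then show ?case using pos[of x] by (auto simp: L_def intro!: divide_right_mono)
    qed
    show "\<forall>\<^sub>F x in at_top. ln (f x + g x) / x \<le> L x + ln 2 / x"
      using eventually_gt_at_top[of 0]
    proof eventually_elim
      case (elim x)
      have "f x + g x \<le> 2 * max (f x) (g x)" by simp
      moreover have mp: "0 < max (f x) (g x)" using pos[of x] by simp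
      ultimately have "ln (f x + g x) \<le> ln (2 * max (f x) (g x))" using pos[of x] by (subst ln_le_cancel_iff) auto
      also have "\<dots> = ln (max (f x) (g x)) + ln 2" using mp by (simp add: ln_mult_pos)
      finally have "ln (f x + g x) / x \<le> (ln (max (f x) (g x)) + ln 2) / x"
        using elim by (intro divide_right_mono) auto
      moreover have "ln (max (f x) (g x)) / x \<le> L x" by (simp add: L_def max_def)
      ultimately show ?case by (simp add: add_divide_distrib)
    qed
  qed
  then show ?thesis using pos by (simp add: has_val_def add_pos_pos)
qed

lemma has_val_sum:
  assumes "finite K" "K \<noteq> {}" "\<And>b. b \<in> K \<Longrightarrow> 0 < c b" "\<And>b. b \<in> K \<Longrightarrow> has_val (f b) (v b)"
  shows "has_val (\<lambda>x. \<Sum>b\<in>K. c b * f b x) (Min (v ` K))"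
proof -
  have cf: "has_val (\<lambda>x. c b * f b x) (v b)" if "b \<in> K" for b
    using has_val_mult[OF has_val_const[OF assms(3)[OF that]] assms(4)[OF that]] by simp
  show ?thesis using assms(1,2) cf
  proof (induction K rule: finite_ne_induct)
    case (insert a K)
    then have "has_val (\<lambda>x. c a * f a x + (\<Sum>b\<in>K. c b * f b x)) (min (v a) (Min (v ` K)))"
      by (intro has_val_add) auto
    then show ?case using insert by simp
  qed auto
qed

section \<open>Flag minors and their incidence relations\<close>

text \<open>Expansion along the last row: on finite sets \<open>P X\<close> is \<open>P {}\<close>
  times the determinant of the rows \<open>1..card X\<close> and the columns X of A. The exponent
  counts the columns to the right of \<open>i\<close>.\<close>

definition laplace :: "(nat \<Rightarrow> nat \<Rightarrow> real) \<Rightarrow> (nat set \<Rightarrow> real) \<Rightarrow> bool" where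
  "laplace A P \<longleftrightarrow> (\<forall>X. finite X \<and> X \<noteq> {} \<longrightarrow>
     P X = (\<Sum>i\<in>X. (-1) ^ card {x\<in>X. i < x} * A (card X) i * P (X - {i})))"

lemma laplaceD:
  "laplace A P \<Longrightarrow> finite X \<Longrightarrow> X \<noteq> {} \<Longrightarrow>
    P X = (\<Sum>i\<in>X. (-1) ^ card {x\<in>X. i < x} * A (card X) i * P (X - {i}))"
  by (simp add: laplace_def)

lemma card_Collect_remove:
  assumes "finite X" "i \<in> X"
  shows "card {x\<in>X. Q x} = card {x\<in>X - {i}. Q x} + (if Q i then 1 else 0)"
proof -
  have "X = insert i (X - {i})" using assms by auto
  then have "card {x\<in>X. Q x} = card {x\<in>insert i (X - {i}). Q x}" by simp
  also have "\<dots> = card {x\<in>X - {i}. Q x} + (if Q i then 1 else 0)"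
    using assms by (intro card_Collect_insert) auto
  finally show ?thesis .
qed

lemma sum_swap_distinct:
  assumes "finite J"
  shows "(\<Sum>j\<in>J. \<Sum>i\<in>J - {j}. T j i) = (\<Sum>j\<in>J. \<Sum>i\<in>J - {j}. T i j)"
proof -
  have e: "J - {j} = {i \<in> J. i \<noteq> j}" "J - {j} = {i \<in> J. j \<noteq> i}" for j by auto
  show ?thesis
    using sum.swap_restrict[OF assms assms, of T "\<lambda>j i. i \<noteq> j"] unfolding e(1)[symmetric] e(2)[symmetric] .
qed

(* the alternating sum is the determinant with row r repeated *)
lemma laplace_repeated_row:
  assumes "laplace A P" "finite J" "1 \<le> r" "r < card J"
  shows "(\<Sum>j\<in>J. (-1) ^ card {x\<in>J. j < x} * A r j * P (J - {j})) = 0"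
  using assms(2,4)
proof (induction "card J" arbitrary: J)
  case (Suc s)
  define u where "u j X = card {x\<in>X. j < x}" for j :: nat and X
  define T where "T j i = (-1) ^ u j J * A r j * ((-1) ^ u i (J - {j}) * A s i * P (J - {j} - {i}))" for j i
  have cs: "card (J - {j}) = s" if "j \<in> J" for j using Suc that by simp
  have s: "1 \<le> s" "r \<le> s" using Suc assms(3) by auto
  have exp: "P (J - {j}) = (\<Sum>i\<in>J - {j}. (-1) ^ u i (J - {j}) * A s i * P (J - {j} - {i}))" if "j \<in> J" for j
  proof -
    have "J - {j} \<noteq> {}" using cs[OF that] s(1) by (metis card.empty not_one_le_zero)
    then show ?thesis using laplaceD[OF assms(1), of "J - {j}"] Suc.prems(1) cs[OF that] by (simp add: u_def)
  qed
  have sgn: "(-1::real) ^ u j J * (-1) ^ u i (J - {j}) = - ((-1) ^ u i J * (-1) ^ u j (J - {i}))"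
    if "i \<in> J" "j \<in> J" "i \<noteq> j" for i j
    unfolding u_def using that
      card_Collect_remove[OF Suc.prems(1) that(2), of "\<lambda>x. i < x"] card_Collect_remove[OF Suc.prems(1) that(1), of "\<lambda>x. j < x"]
    by (auto simp: power_add)
  have LHS: "(\<Sum>j\<in>J. (-1) ^ card {x\<in>J. j < x} * A r j * P (J - {j})) = (\<Sum>j\<in>J. \<Sum>i\<in>J - {j}. T j i)"
    unfolding u_def[symmetric] by (intro sum.cong refl) (simp add: exp T_def sum_distrib_left)
  \<comment> \<open>For \<open>r = s\<close> the double sum is antisymmetric in the two columns.
    Otherwise it is regrouped by the column that row \<open>s\<close> uses, and each inner sum
    repeats row \<open>r\<close> over a set with one column less.\<close>
  show ?case
  proof (cases "r = s")
    case True
    have anti: "T i j = - T j i" if "i \<in> J" "j \<in> J" "i \<noteq> j" for i j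
    proof -
      have "J - {i} - {j} = J - {j} - {i}" by auto
      then have "T i j = ((-1) ^ u i J * (-1) ^ u j (J - {i})) * (A s i * A s j * P (J - {j} - {i}))"
        "T j i = ((-1) ^ u j J * (-1) ^ u i (J - {j})) * (A s i * A s j * P (J - {j} - {i}))"
        by (auto simp: T_def True)
      then show ?thesis using sgn[OF that] by simp
    qed
    have "(\<Sum>j\<in>J. \<Sum>i\<in>J - {j}. T i j) = (\<Sum>j\<in>J. \<Sum>i\<in>J - {j}. - T j i)"
      by (intro sum.cong refl anti) auto
    then show ?thesis unfolding LHS using sum_swap_distinct[OF Suc.prems(1), of T] by (simp add: sum_negf)
  next
    case False
    have "(\<Sum>i\<in>J - {j}. T i j) = 0" if j: "j \<in> J" for j
    proof -
      have "T i j = - ((-1) ^ u j J * A s j) * ((-1) ^ u i (J - {j}) * A r i * P (J - {j} - {i}))"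
        if i: "i \<in> J - {j}" for i
      proof -
        have "J - {i} - {j} = J - {j} - {i}" by auto
        then have t: "T i j = ((-1) ^ u i J * (-1) ^ u j (J - {i})) * (A r i * A s j * P (J - {j} - {i}))"
          by (auto simp: T_def)
        show ?thesis unfolding t by (subst sgn[of j i]) (use i j in \<open>auto simp: algebra_simps\<close>)
      qed
      then have "(\<Sum>i\<in>J - {j}. T i j) =
          - ((-1) ^ u j J * A s j) * (\<Sum>i\<in>J - {j}. (-1) ^ u i (J - {j}) * A r i * P (J - {j} - {i}))"
        by (simp add: sum_distrib_left)
      also have "(\<Sum>i\<in>J - {j}. (-1) ^ u i (J - {j}) * A r i * P (J - {j} - {i})) = 0"
        unfolding u_def using cs[OF j] s False Suc.prems(1) by (intro Suc.hyps(1)) auto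
      finally show ?thesis by simp
    qed
    then show ?thesis unfolding LHS sum_swap_distinct[OF Suc.prems(1), of T] by simp
  qed
qed simp

text \<open>Induction on the size of I, expanding \<open>P (insert j I)\<close> along its last row
  \<open>r\<close>. The column \<open>j\<close> contributes a multiple of \<open>P I\<close>; each
  column \<open>i\<close> of I contributes the relation of \<open>I - {i}\<close>. What remains is
  \<open>P I\<close> times a determinant of size \<open>card J\<close> with row \<open>r\<close>
  repeated, and the gap of two between the cardinalities ensures \<open>r < card J\<close>.\<close>

lemma laplace_incidence:
  assumes lap: "laplace A P" and "finite I" "finite J" "card I + 2 \<le> card J"
  shows "(\<Sum>j\<in>J - I. (-1) ^ (card {k\<in>J. k < j} + card {i\<in>I. j < i}) * P (insert j I) * P (J - {j})) = 0"
  using assms(2,4)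
proof (induction "card I" arbitrary: I rule: less_induct)
  case less
  define u where "u j X = card {x\<in>X. j < x}" for j :: nat and X
  define l where "l j = card {k\<in>J. k < j}" for j
  define r where "r = Suc (card I)"
  have finI: "finite I" by fact
  define Q where "Q K i j = (-1) ^ (l j + u j K) * P (insert j K) * P (J - {j})" for K and i j :: nat
  have expand: "(-1) ^ (l j + u j I) * P (insert j I) * P (J - {j}) =
      P I * ((-1) ^ l j * A r j * P (J - {j})) - (\<Sum>i\<in>I. (-1) ^ u i I * A r i * Q (I - {i}) i j)"
    if j: "j \<in> J - I" for j
  proof -
    have jI: "j \<notin> I" using j by simp
    have "P (insert j I) = (\<Sum>i\<in>insert j I. (-1) ^ u i (insert j I) * A r i * P (insert j I - {i}))"
      using laplaceD[OF lap, of "insert j I"] finI jI by (simp add: u_def r_def)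
    also have "\<dots> = (-1) ^ u j (insert j I) * A r j * P (insert j I - {j}) +
        (\<Sum>i\<in>I. (-1) ^ u i (insert j I) * A r i * P (insert j I - {i}))"
      using finI jI by simp
    also have "insert j I - {j} = I" using jI by auto
    also have "u j (insert j I) = u j I" unfolding u_def using card_Collect_insert[OF finI jI] by simp
    also have "(\<Sum>i\<in>I. (-1) ^ u i (insert j I) * A r i * P (insert j I - {i})) =
       (\<Sum>i\<in>I. (-1) ^ (u i I + (if i < j then 1 else 0)) * A r i * P (insert j (I - {i})))"
    proof (intro sum.cong refl)
      fix i assume i: "i \<in> I"
      have "insert j I - {i} = insert j (I - {i})" using i jI by auto
      moreover have "u i (insert j I) = u i I + (if i < j then 1 else 0)"
        unfolding u_def using card_Collect_insert[OF finI jI] by simp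
      ultimately show "(-1) ^ u i (insert j I) * A r i * P (insert j I - {i}) =
        (-1) ^ (u i I + (if i < j then 1 else 0)) * A r i * P (insert j (I - {i}))" by simp
    qed
    finally have e: "P (insert j I) = (-1) ^ u j I * A r j * P I +
      (\<Sum>i\<in>I. (-1) ^ (u i I + (if i < j then 1 else 0)) * A r i * P (insert j (I - {i})))" .
    have s: "(-1) ^ (l j + u j I) * ((-1) ^ (u i I + (if i < j then 1 else 0)) * A r i * P (insert j (I - {i}))) * P (J - {j})
      = - ((-1) ^ u i I * A r i * Q (I - {i}) i j)" if i: "i \<in> I" for i
    proof -
      have uj: "u j I = u j (I - {i}) + (if i < j then 0 else 1)"
        unfolding u_def using card_Collect_remove[OF finI i, of "\<lambda>x. j < x"] i jI by (auto simp: not_less_iff_gr_or_eq)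
      show ?thesis unfolding Q_def uj by (cases "i < j") (simp_all add: power_add mult_ac)
    qed
    have "(-1) ^ (l j + u j I) * P (insert j I) * P (J - {j}) =
      (-1) ^ (l j + u j I) * ((-1) ^ u j I * A r j * P I) * P (J - {j}) +
      (\<Sum>i\<in>I. (-1) ^ (l j + u j I) * ((-1) ^ (u i I + (if i < j then 1 else 0)) * A r i * P (insert j (I - {i}))) * P (J - {j}))"
      unfolding e by (simp add: distrib_left distrib_right sum_distrib_left sum_distrib_right)
    also have "(\<Sum>i\<in>I. (-1) ^ (l j + u j I) * ((-1) ^ (u i I + (if i < j then 1 else 0)) * A r i * P (insert j (I - {i}))) * P (J - {j}))
      = - (\<Sum>i\<in>I. (-1) ^ u i I * A r i * Q (I - {i}) i j)" unfolding sum_negf[symmetric] by (intro sum.cong refl s)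
    also have "(-1) ^ (l j + u j I) * ((-1) ^ u j I * A r j * P I) * P (J - {j}) = P I * ((-1) ^ l j * A r j * P (J - {j}))"
      by (simp add: power_add)
    finally show ?thesis by simp
  qed
  \<comment> \<open>The vanishing relation of \<open>I - {i}\<close> has one more index than
    \<open>J - I\<close> exactly if \<open>i\<close> is in J. These leftovers complete the sum over
    \<open>J - I\<close> to a sum over J.\<close>
  have inner: "(\<Sum>j\<in>J - I. Q (I - {i}) i j) = - (if i \<in> J then (-1) ^ (l i + u i I) * P I * P (J - {i}) else 0)"
    if i: "i \<in> I" for i
  proof -
    have "card (I - {i}) < card I" using finI i by (rule card_Diff1_less)
    then have 0: "(\<Sum>j\<in>J - (I - {i}). Q (I - {i}) i j) = 0"
      unfolding Q_def u_def l_def using less.prems by (intro less.hyps) auto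
    show ?thesis
    proof (cases "i \<in> J")
      case True
      have "u i I = u i (I - {i})" unfolding u_def using card_Collect_remove[OF finI i, of "\<lambda>x. i < x"] by simp
      then have qi: "Q (I - {i}) i i = (-1) ^ (l i + u i I) * P I * P (J - {i})" using i by (simp add: Q_def insert_absorb)
      have "J - (I - {i}) = insert i (J - I)" using True by auto
      then have "(\<Sum>j\<in>J - (I - {i}). Q (I - {i}) i j) = Q (I - {i}) i i + (\<Sum>j\<in>J - I. Q (I - {i}) i j)"
        using assms(3) i by simp
      then show ?thesis using 0 qi True by simp
    next
      case False
      then have "J - (I - {i}) = J - I" by auto
      then show ?thesis using 0 False by simp
    qed
  qed
  have "(\<Sum>j\<in>J - I. (-1) ^ (l j + u j I) * P (insert j I) * P (J - {j})) =
     P I * (\<Sum>j\<in>J - I. (-1) ^ l j * A r j * P (J - {j})) -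
     (\<Sum>j\<in>J - I. \<Sum>i\<in>I. (-1) ^ u i I * A r i * Q (I - {i}) i j)"
    by (simp add: expand sum_subtractf sum_distrib_left)
  also have "(\<Sum>j\<in>J - I. \<Sum>i\<in>I. (-1) ^ u i I * A r i * Q (I - {i}) i j) =
     (\<Sum>i\<in>I. (-1) ^ u i I * A r i * (\<Sum>j\<in>J - I. Q (I - {i}) i j))"
    by (subst sum.swap) (simp add: sum_distrib_left)
  also have "\<dots> = (\<Sum>i\<in>I. if i \<in> J then - (P I * ((-1) ^ l i * A r i * P (J - {i}))) else 0)"
    by (intro sum.cong refl) (simp add: inner power_add)
  also have "\<dots> = - (P I * (\<Sum>i\<in>I \<inter> J. (-1) ^ l i * A r i * P (J - {i})))"
    unfolding sum.inter_restrict[OF finI] sum_distrib_left sum_negf[symmetric] by (intro sum.cong) auto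
  finally have "(\<Sum>j\<in>J - I. (-1) ^ (l j + u j I) * P (insert j I) * P (J - {j})) =
     P I * ((\<Sum>j\<in>J - I. (-1) ^ l j * A r j * P (J - {j})) + (\<Sum>j\<in>I \<inter> J. (-1) ^ l j * A r j * P (J - {j})))"
    by (simp add: distrib_left)
  also have "(\<Sum>j\<in>J - I. (-1) ^ l j * A r j * P (J - {j})) + (\<Sum>j\<in>I \<inter> J. (-1) ^ l j * A r j * P (J - {j})) =
     (\<Sum>j\<in>J. (-1) ^ l j * A r j * P (J - {j}))"
    using sum.Int_Diff[OF assms(3), of "\<lambda>j. (-1) ^ l j * A r j * P (J - {j})" I] by (simp add: Int_commute)
  \<comment> \<open>Incidence signs count the columns to the left, Laplace signs those to the right;
    the two counts add up to \<open>card J - 1\<close>, which factors out as a global sign.\<close>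
  also have "\<dots> = (\<Sum>j\<in>J. (-1) ^ (card J - 1) * ((-1) ^ u j J * A r j * P (J - {j})))"
  proof (intro sum.cong refl)
    fix j assume j: "j \<in> J"
    have lu: "l j + u j J = card J - 1"
      using card_below_above[of "J - {j}" j] card_Collect_remove[OF assms(3) j, of "\<lambda>x. j < x"]
        card_Collect_remove[OF assms(3) j, of "\<lambda>x. x < j"] assms(3) j by (simp add: l_def u_def)
    have "(-1::real) ^ (card J - 1) * (-1) ^ u j J = (-1) ^ l j"
      unfolding lu[symmetric] by (simp add: power_add)
    then show "(-1) ^ l j * A r j * P (J - {j}) = (-1) ^ (card J - 1) * ((-1) ^ u j J * A r j * P (J - {j}))"
      by (simp add: mult.assoc[symmetric])
  qed
  also have "\<dots> = 0"
    using laplace_repeated_row[OF lap assms(3), of r] less.prems(2) by (simp add: r_def u_def flip: sum_distrib_left)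
  finally show ?case by (simp add: l_def u_def)
qed

section \<open>Matrices with prescribed interval minors\<close>

text \<open>This solves the expansion of the minor on the k consecutive columns ending at
  \<open>j\<close> for its last entry, so that the minor becomes \<open>d j\<close>. F gives the
  minors of size k - 1, and the divisor is one on an interval. For \<open>j < k\<close> no such
  interval starts at 1 or later, and the entry is set to 0.\<close>

fun row_entry :: "(nat \<Rightarrow> real) \<Rightarrow> (nat set \<Rightarrow> real) \<Rightarrow> nat \<Rightarrow> nat \<Rightarrow> real" where
  "row_entry d F k j = (if j < k then 0 else
     (d j - (\<Sum>l\<in>{Suc j - k..<j}. (-1) ^ (j - l) * row_entry d F k l * F ({Suc j - k..j} - {l})))
       / F {Suc j - k..<j})"

declare row_entry.simps [simp del]

text \<open>At level k the value is meaningful on sets of size k. Row \<open>Suc k\<close> is built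
  from the minors of the previous level, and \<open>Suc j - Suc k\<close> is the first column of the
  interval of length \<open>Suc k\<close> ending at \<open>j\<close>.\<close>

primrec level_minor :: "(nat \<Rightarrow> nat \<Rightarrow> real) \<Rightarrow> nat \<Rightarrow> nat set \<Rightarrow> real" where
  "level_minor d 0 = (\<lambda>X. 1)"
| "level_minor d (Suc k) = (\<lambda>X. \<Sum>i\<in>X. (-1) ^ card {x\<in>X. i < x} *
     row_entry (\<lambda>j. d (Suc j - Suc k) j) (level_minor d k) (Suc k) i * level_minor d k (X - {i}))"

lemma level_minor_interval:
  assumes d: "\<And>i j. d i j \<noteq> 0"
  shows "1 \<le> i \<Longrightarrow> i \<le> Suc j \<Longrightarrow> Suc j - i = k \<Longrightarrow>
    level_minor d k {i..j} = (if k = 0 then 1 else d i j)"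
proof (induction k arbitrary: i j)
  case (Suc k)
  define F where "F = level_minor d k"
  define a where "a = row_entry (\<lambda>j. d (Suc j - Suc k) j) F (Suc k)"
  have ij: "i \<le> j" "i = j - k" "j \<ge> k + 1" using Suc.prems by auto
  have "F {i..j - 1} = (if k = 0 then 1 else d i (j - 1))"
    unfolding F_def using Suc.prems ij by (intro Suc.IH) auto
  moreover have iv: "{i..j - 1} = {i..<j}" using ij by auto
  ultimately have F0: "F {i..<j} \<noteq> 0" using d by simp
  have "a j = (d i j - (\<Sum>l\<in>{i..<j}. (-1) ^ (j - l) * a l * F ({i..j} - {l}))) / F {i..<j}"
    unfolding a_def using ij by (subst row_entry.simps) simp
  then have aj: "a j * F {i..<j} = d i j - (\<Sum>l\<in>{i..<j}. (-1) ^ (j - l) * a l * F ({i..j} - {l}))"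
    using F0 by simp
  have "level_minor d (Suc k) {i..j} = (\<Sum>l\<in>{i..j}. (-1) ^ card {x\<in>{i..j}. l < x} * a l * F ({i..j} - {l}))"
    by (simp add: a_def F_def)
  also have "\<dots> = (\<Sum>l\<in>{i..j}. (-1) ^ (j - l) * a l * F ({i..j} - {l}))"
  proof (intro sum.cong refl)
    fix l assume "l \<in> {i..j}"
    then have "{x\<in>{i..j}. l < x} = {l<..j}" by auto
    then show "(-1) ^ card {x\<in>{i..j}. l < x} * a l * F ({i..j} - {l}) = (-1) ^ (j - l) * a l * F ({i..j} - {l})" by simp
  qed
  also have "{i..j} = insert j {i..<j}" using ij by auto
  also have "(\<Sum>l\<in>insert j {i..<j}. (-1) ^ (j - l) * a l * F (insert j {i..<j} - {l})) =
    a j * F {i..<j} + (\<Sum>l\<in>{i..<j}. (-1) ^ (j - l) * a l * F ({i..j} - {l}))"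
    using \<open>{i..j} = insert j {i..<j}\<close> by simp
  also have "\<dots> = d i j" using aj by simp
  finally show ?case using \<open>{i..j} = insert j {i..<j}\<close> by simp
qed simp

lemma interval_minors_exist:
  fixes d :: "nat \<Rightarrow> nat \<Rightarrow> real"
  assumes "\<And>i j. d i j \<noteq> 0"
  shows "\<exists>A P. laplace A P \<and> (\<forall>i j. 1 \<le> i \<longrightarrow> i \<le> j \<longrightarrow> P {i..j} = d i j)"
proof (intro exI conjI)
  let ?A = "\<lambda>k. row_entry (\<lambda>j. d (Suc j - k) j) (level_minor d (k - 1)) k"
  let ?P = "\<lambda>X. level_minor d (card X) X"
  show "laplace ?A ?P"
    unfolding laplace_def
  proof (intro allI impI)
    fix X :: "nat set" assume X: "finite X \<and> X \<noteq> {}"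
    then obtain k where k: "card X = Suc k" by (metis card_gt_0_iff gr0_implies_Suc)
    then show "?P X = (\<Sum>i\<in>X. (-1) ^ card {x\<in>X. i < x} * ?A (card X) i * ?P (X - {i}))"
      using X by (simp add: k)
  qed
  show "\<forall>i j. 1 \<le> i \<longrightarrow> i \<le> j \<longrightarrow> ?P {i..j} = d i j"
    using level_minor_interval[of d, OF assms] by auto
qed

section \<open>Recursion from intervals to all sets\<close>

lemma Max_diff_Min_le:
  fixes Y :: "nat set"
  assumes "Y \<subseteq> {a..b}" "Y \<noteq> {}"
  shows "Max Y - Min Y \<le> b - a"
proof -
  have fin: "finite Y" using assms(1) by (rule finite_subset) simp
  have "Max Y \<in> Y" "Min Y \<in> Y" using fin assms(2) by auto
  then have "Max Y \<le> b" "a \<le> Min Y" using assms(1) by auto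
  then show ?thesis by linarith
qed

text \<open>The exchange step has the shape of the three-term relation of S and
  \<open>insert i (insert j (insert k S))\<close>. Its conclusion concerns the product with the
  widest set, and the other five sets have smaller diameter \<open>Max - Min\<close>.\<close>

lemma idx_induct [consumes 1, case_names interval exchange]:
  assumes "X \<in> idx n"
    and int: "\<And>i j. 1 \<le> i \<Longrightarrow> i \<le> j \<Longrightarrow> {i..j} \<in> idx n \<Longrightarrow> Q {i..j}"
    and ex: "\<And>S i j k. insert i (insert j (insert k S)) \<subseteq> {1..n} \<Longrightarrow> i < j \<Longrightarrow> j < k \<Longrightarrow>
      i \<notin> S \<Longrightarrow> j \<notin> S \<Longrightarrow> k \<notin> S \<Longrightarrow> insert i (insert k S) \<in> idx n \<Longrightarrow>
      Q (insert i S) \<Longrightarrow> Q (insert j S) \<Longrightarrow> Q (insert k S) \<Longrightarrow>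
      Q (insert i (insert j S)) \<Longrightarrow> Q (insert j (insert k S)) \<Longrightarrow> Q (insert i (insert k S))"
  shows "Q X"
  using assms(1)
proof (induction "Max X - Min X" arbitrary: X rule: less_induct)
  case less
  have X: "X \<subseteq> {1..n}" "1 \<le> card X" "card X \<le> n - 1" using less.prems by (auto simp: idx_def)
  have fin: "finite X" and ne: "X \<noteq> {}" using X by (auto intro: finite_subset)
  define i where "i = Min X"
  define k where "k = Max X"
  have ik: "i \<in> X" "k \<in> X" using fin ne by (auto simp: i_def k_def)
  have sub: "X \<subseteq> {i..k}" using fin by (auto simp: i_def k_def)
  have i1: "1 \<le> i" "i \<le> k" "k \<le> n" using ik sub X by auto
  show ?case
  proof (cases "X = {i..k}")
    case True
    then show ?thesis using int[of i k] less.prems i1 by simp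
  next
    case False
    \<comment> \<open>A gap of X between its extreme elements \<open>i\<close> and \<open>k\<close>.
      Each of the five other sets omits \<open>i\<close> or \<open>k\<close>, hence lies in a
      shorter range.\<close>
    then obtain j where j: "j \<in> {i..k}" "j \<notin> X" using sub by blast
    then have ijk: "i < j" "j < k" using ik by (auto simp: le_less)
    define S where "S = X - {i, k}"
    have Xeq: "X = insert i (insert k S)" using ik by (auto simp: S_def)
    have Ss: "S \<subseteq> {i<..<k}" using sub by (force simp: S_def)
    have nS: "i \<notin> S" "j \<notin> S" "k \<notin> S" using j by (auto simp: S_def)
    have finS: "finite S" using fin by (simp add: S_def)
    have cX: "card X = card S + 2" using finS nS ijk by (simp add: Xeq)
    have S1: "S \<subseteq> {1..n}" using X by (auto simp: S_def)
    have less1: "Q Y" if Y: "Y \<in> idx n" "Y \<subseteq> {i..<k} \<or> Y \<subseteq> {i<..k}" for Y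
    proof (rule less.hyps[OF _ Y(1)])
      have "Y \<noteq> {}" using Y(1) by (auto simp: idx_def)
      moreover have "{i..<k} \<subseteq> {i..k - 1}" "{i<..k} \<subseteq> {i+1..k}" by auto
      ultimately have "Max Y - Min Y \<le> k - 1 - i \<or> Max Y - Min Y \<le> k - (i + 1)"
        using Max_diff_Min_le[of Y i "k - 1"] Max_diff_Min_le[of Y "i+1" k] Y(2) by blast
      then show "Max Y - Min Y < Max X - Min X" using ijk by (auto simp: i_def[symmetric] k_def[symmetric])
    qed
    have mem: "insert i S \<in> idx n" "insert j S \<in> idx n" "insert k S \<in> idx n"
      "insert i (insert j S) \<in> idx n" "insert j (insert k S) \<in> idx n"
      using finS nS ijk i1 S1 X(3) cX by (auto simp: idx_def)
    show ?thesis unfolding Xeq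
    proof (rule ex[of i j k S])
      show "insert i (insert j (insert k S)) \<subseteq> {1..n}" using S1 ijk i1 by auto
      show "insert i (insert k S) \<in> idx n" using less.prems Xeq by simp
      show "Q (insert i S)" by (rule less1[OF mem(1)]) (use Ss ijk in force)
      show "Q (insert j S)" by (rule less1[OF mem(2)]) (use Ss ijk in force)
      show "Q (insert k S)" by (rule less1[OF mem(3)]) (use Ss ijk in force)
      show "Q (insert i (insert j S))" by (rule less1[OF mem(4)]) (use Ss ijk in force)
      show "Q (insert j (insert k S))" by (rule less1[OF mem(5)]) (use Ss ijk in force)
    qed (use ijk nS in auto)
  qed
qed


section \<open>The three tropical sets\<close>

lemma even_sign_three:
  fixes i j k :: nat
  assumes "finite S" "i < j" "j < k" "i \<notin> S" "j \<notin> S" "k \<notin> S"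
  defines "J \<equiv> insert i (insert j (insert k S))"
  shows "even_sign i S J \<longleftrightarrow> even (card S)" "even_sign j S J \<longleftrightarrow> odd (card S)" "even_sign k S J \<longleftrightarrow> even (card S)"
proof -
  have "even_sign x S J \<longleftrightarrow> even (card S + ((if i < x then 1 else 0) + (if j < x then 1 else 0) + (if k < x then 1 else 0)))"
    if "x \<in> {i, j, k}" for x
  proof -
    have "even_sign x (S \<union> {}) (S \<union> {i,j,k}) \<longleftrightarrow> even (card S + card {w\<in>{i,j,k}. w < x} + card {w\<in>{}. x < w})"
      using assms(1-6) that by (intro even_sign_common_part) auto
    moreover have "S \<union> {i, j, k} = J" by (auto simp: J_def)
    moreover have "card {w\<in>{i,j,k}. w < x} = (if i < x then 1 else 0) + (if j < x then 1 else 0) + (if k < x then 1 else 0)"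
      using assms(2,3) by (intro card_Collect_three) auto
    ultimately show ?thesis by simp
  qed
  from this[of i] this[of j] this[of k] assms(2,3)
  show "even_sign i S J \<longleftrightarrow> even (card S)" "even_sign j S J \<longleftrightarrow> odd (card S)" "even_sign k S J \<longleftrightarrow> even (card S)"
    by auto
qed

lemma ip_pair_idx:
  assumes "ip_pair n I J" "j \<in> J" "j \<notin> I"
  shows "insert j I \<in> idx n" "J - {j} \<in> idx n"
proof -
  have fin: "finite I" "finite J" using ip_pair_finite[OF assms(1)] by auto
  have "card J \<le> n" using assms(1) card_mono[of "{1..n}" J] by (auto simp: ip_pair_def)
  then show "insert j I \<in> idx n" "J - {j} \<in> idx n"
    using assms fin by (auto simp: ip_pair_def idx_def)
qed

lemma ip_rel_in_IP_rels:
  assumes "ip_pair n I J"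
  shows "ip_rel I J \<in> IP_rels n"
proof -
  have "card J \<le> n" using assms card_mono[of "{1..n}" J] by (auto simp: ip_pair_def)
  then show ?thesis using assms unfolding IP_rels_def ip_pair_def
    by (intro CollectI exI[of _ I] exI[of _ J] exI[of _ "card I + 1"] exI[of _ "card J - 1"]) auto
qed

lemma ip_rel_in_IP_rels3:
  assumes "ip_pair n I J" "card (J - I) = 3"
  shows "ip_rel I J \<in> IP_rels3 n"
proof -
  have "card J \<le> n" using assms card_mono[of "{1..n}" J] by (auto simp: ip_pair_def)
  then show ?thesis using assms unfolding IP_rels3_def ip_pair_def
    by (intro CollectI exI[of _ I] exI[of _ J] exI[of _ "card I + 1"] exI[of _ "card J - 1"]) auto
qed

lemma IP_relsE:
  assumes "g \<in> IP_rels n"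
  obtains I J where "g = ip_rel I J" "ip_pair n I J"
  using assms unfolding IP_rels_def ip_pair_def by force

lemma IP_rels3_subset: "IP_rels3 n \<subseteq> IP_rels n"
  unfolding IP_rels_def IP_rels3_def by blast

text \<open>Minors and tropical coordinates obey the same recursion, one by
  \<open>laplace_incidence\<close>, the other by \<open>rel\<close>; \<open>has_val\<close> matches
  sum, product and quotient with minimum, sum and difference. Positivity of the minors is part of
  the induction and keeps the divisor nonzero.\<close>

lemma finite_point_lift:
  fixes y :: "nat set \<Rightarrow> real"
  assumes rel: "\<And>I J. ip_pair n I J \<Longrightarrow> card (J - I) = 3 \<Longrightarrow> pos_rel (\<lambda>X. ereal (y X)) I J"
  obtains A P where "\<And>x. laplace (A x) (P x)" "\<And>X. X \<in> idx n \<Longrightarrow> has_val (\<lambda>x. P x X) (y X)"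
proof -
  have "\<exists>A P. laplace A P \<and> (\<forall>i j. 1 \<le> i \<longrightarrow> i \<le> j \<longrightarrow> P {i..j} = exp (- (x * y {i..j})))" for x
    by (rule interval_minors_exist[of "\<lambda>i j. exp (- (x * y {i..j}))"]) simp
  then obtain A P where lap: "\<And>x. laplace (A x) (P x)"
    and int: "\<And>x i j. 1 \<le> i \<Longrightarrow> i \<le> j \<Longrightarrow> P x {i..j} = exp (- (x * y {i..j}))" by metis
  have "has_val (\<lambda>x. P x X) (y X)" if "X \<in> idx n" for X
    using that
  proof (induction rule: idx_induct)
    case (interval i j)
    then show ?case using has_val_exp[of "y {i..j}"] int by simp
  next
    case (exchange S i j k)
    define J where "J = insert i (insert j (insert k S))"
    have finJ: "finite J" using exchange.hyps(1) unfolding J_def by (rule finite_subset) simp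
    then have finS: "finite S" by (simp add: J_def)
    have d: "i \<noteq> j" "j \<noteq> k" "i \<noteq> k" using exchange.hyps by auto
    note nS = exchange.hyps(4-6)
    have diff: "J - S = {i, j, k}" using nS by (auto simp: J_def)
    have cJ: "card J = card S + 3" using finS nS d by (simp add: J_def)
    have pr: "ip_pair n S J" using exchange.hyps(1) cJ by (auto simp: ip_pair_def J_def)
    note sg = even_sign_three[OF finS exchange.hyps(2,3) nS, folded J_def]
    have rm: "J - {i} = insert j (insert k S)" "J - {j} = insert i (insert k S)" "J - {k} = insert i (insert j S)"
      using nS d by (auto simp: J_def)
    have "pos_rel (\<lambda>X. ereal (y X)) S J" using rel[OF pr] diff d by simp
    from pos_rel_three_terms[OF this diff] sg
    have "ereal (y (insert j S)) + ereal (y (J - {j})) =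
      min (ereal (y (insert i S)) + ereal (y (J - {i}))) (ereal (y (insert k S)) + ereal (y (J - {k})))" by simp
    then have val: "y (insert i (insert k S)) = min (y (insert i S) + y (insert j (insert k S)))
       (y (insert k S) + y (insert i (insert j S))) - y (insert j S)"
      unfolding rm by (auto simp: min_def split: if_splits)
    have eq: "P x (insert i (insert k S)) = (P x (insert i S) * P x (insert j (insert k S)) +
       P x (insert k S) * P x (insert i (insert j S))) / P x (insert j S)" for x
    proof -
      have "(\<Sum>l\<in>{i,j,k}. (-1) ^ (card {w\<in>J. w < l} + card {w\<in>S. l < w}) * P x (insert l S) * P x (J - {l})) = 0"
        using laplace_incidence[OF lap finS finJ, of x] cJ by (simp only: diff)
      moreover have "(-1::real) ^ (card {w\<in>J. w < l} + card {w\<in>S. l < w}) = (if even_sign l S J then 1 else -1)" for l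
        by (simp add: even_sign_def)
      ultimately have "P x (insert j S) * P x (insert i (insert k S)) =
        P x (insert i S) * P x (insert j (insert k S)) + P x (insert k S) * P x (insert i (insert j S))"
        using d sg by (auto simp: rm split: if_splits)
      then show ?thesis using has_val_pos[OF exchange.IH(2), of x] by (simp add: field_simps)
    qed
    show ?case unfolding eq val
      by (intro has_val_divide has_val_add has_val_mult exchange.IH)
  qed
  with lap that show ?thesis by blast
qed

lemma trop_pos_sol_finite_point:
  fixes y :: "nat set \<Rightarrow> real"
  assumes rel: "\<And>I J. ip_pair n I J \<Longrightarrow> card (J - I) = 3 \<Longrightarrow> pos_rel (\<lambda>X. ereal (y X)) I J"
    and p: "p \<in> ideal_gen (IP_rels n)" "p \<noteq> 0"
  shows "trop_pos_sol (\<lambda>X. ereal (y X)) p"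
proof -
  obtain A P where lap: "\<And>x. laplace (A x) (P x)"
    and val: "\<And>X. X \<in> idx n \<Longrightarrow> has_val (\<lambda>x. P x X) (y X)"
    using finite_point_lift[OF rel] by blast
  \<comment> \<open>Multipliers in \<open>ideal_gen\<close> may contain variables outside
    \<open>idx n\<close>. These get any positive function of the right valuation, while the
    generators involve only variables in \<open>idx n\<close>.\<close>
  define R where "R x X = (if X \<in> idx n then P x X else exp (- (x * y X)))" for x X
  have R: "has_val (\<lambda>x. R x X) (y X)" for X
    using val[of X] has_val_exp[of "y X"] by (cases "X \<in> idx n") (auto simp: R_def)
  have zero: "poly_eval (R x) p = 0" for x
  proof (rule poly_eval_ideal[OF p(1)])
    fix g assume "g \<in> IP_rels n"
    then obtain I J where g: "g = ip_rel I J" "ip_pair n I J" by (rule IP_relsE)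
    have "poly_eval (R x) g = (\<Sum>j\<in>J - I. (-1) ^ (card {k\<in>J. k < j} + card {i\<in>I. j < i}) * P x (insert j I) * P x (J - {j}))"
      unfolding g(1) poly_eval_ip_rel
      by (intro sum.cong refl) (use ip_pair_idx[OF g(2)] in \<open>auto simp: R_def ip_sign_def\<close>)
    also have "\<dots> = 0"
      using laplace_incidence[OF lap] ip_pair_finite[OF g(2)] g(2) by (auto simp: ip_pair_def)
    finally show "poly_eval (R x) g = 0" .
  qed
  define tv where "tv b = (\<Sum>I\<in>Poly_Mapping.keys b. real (Poly_Mapping.lookup b I) * y I)" for b
  have tv: "term_val (\<lambda>X. ereal (y X)) b = ereal (tv b)" for b
    by (simp add: term_val_def tv_def)
  have mv: "has_val (\<lambda>x. mono_eval (R x) b) (tv b)" for b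
    unfolding mono_eval_def tv_def by (intro has_val_prod has_val_power R)
  define p1 where "p1 x = (\<Sum>b\<in>pos_keys p. Poly_Mapping.lookup p b * mono_eval (R x) b)" for x
  define p2 where "p2 x = (\<Sum>b\<in>neg_keys p. - Poly_Mapping.lookup p b * mono_eval (R x) b)" for x
  have "poly_eval (R x) p = p1 x - p2 x" for x
  proof -
    have "pos_keys p \<inter> neg_keys p = {}" by (auto simp: pos_keys_def neg_keys_def)
    then show ?thesis unfolding poly_eval_def keys_eq_pos_neg p1_def p2_def
      by (subst sum.union_disjoint) (auto simp: sum_negf)
  qed
  \<comment> \<open>Moving the negative terms to the other side leaves two positive sums without
    cancellation; their valuations are the two minima to be compared. If one sign were absent, a
    positive sum would equal 0.\<close>
  then have eq: "p1 = p2" using zero by (auto simp: fun_eq_iff)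
  have h1: "pos_keys p \<noteq> {} \<Longrightarrow> has_val p1 (Min (tv ` pos_keys p))"
    unfolding p1_def by (intro has_val_sum mv) (auto simp: pos_keys_def)
  have h2: "neg_keys p \<noteq> {} \<Longrightarrow> has_val p2 (Min (tv ` neg_keys p))"
    unfolding p2_def by (intro has_val_sum mv) (auto simp: neg_keys_def)
  have "Poly_Mapping.keys p \<noteq> {}" using p(2) by simp
  then have "pos_keys p \<noteq> {} \<or> neg_keys p \<noteq> {}" unfolding keys_eq_pos_neg by auto
  moreover have "pos_keys p = {} \<Longrightarrow> p1 0 = 0" "neg_keys p = {} \<Longrightarrow> p2 0 = 0" by (auto simp: p1_def p2_def)
  ultimately have ne: "pos_keys p \<noteq> {}" "neg_keys p \<noteq> {}"
    using eq has_val_pos[OF h1, of 0] has_val_pos[OF h2, of 0] by fastforce+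
  have Min_ereal: "Min ((\<lambda>b. ereal (tv b)) ` K) = ereal (Min (tv ` K))" if "finite K" "K \<noteq> {}" for K
    using mono_Min_commute[of ereal "tv ` K"] that by (simp add: image_image mono_def)
  have "Min (tv ` pos_keys p) = Min (tv ` neg_keys p)"
    using has_val_unique[OF h1[OF ne(1)]] h2[OF ne(2)] eq by simp
  then show ?thesis unfolding trop_pos_sol_iff tv using ne by (simp add: Min_ereal)
qed

section \<open>Approaching points with infinite coordinates\<close>

lemma swap_in_idx:
  assumes "X \<in> idx n" "p \<in> {1..n}" "q \<in> X" "p \<notin> X"
  shows "swap_in p q X \<in> idx n" "card (swap_in p q X) = card X"
proof -
  have "finite X" using assms(1) by (auto simp: idx_def intro: finite_subset)
  then show "card (swap_in p q X) = card X" using assms by (intro card_swap_in)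
  then show "swap_in p q X \<in> idx n" using assms by (auto simp: idx_def swap_in_def)
qed

text \<open>Sets of equal size are connected through exchanges of neighbouring integers. If no such
  exchange passed from an infinite to a finite coordinate, finiteness would be constant on each
  size.\<close>

lemma infinite_coordinate_frontier:
  assumes X0: "X0 \<in> idx n" "y X0 = (\<infinity>::ereal)" and Y0: "Y0 \<in> idx n" "card Y0 = card X0" "y Y0 \<noteq> \<infinity>"
  obtains p q X where "p = Suc q \<or> q = Suc p" "p \<in> {1..n}" "q \<in> {1..n}" "X \<in> idx n" "q \<in> X" "p \<notin> X"
    "y X = \<infinity>" "y (swap_in p q X) \<noteq> \<infinity>"
proof -
  have "\<exists>p q X. (p = Suc q \<or> q = Suc p) \<and> p \<in> {1..n} \<and> q \<in> {1..n} \<and> X \<in> idx n \<and> q \<in> X \<and> p \<notin> X \<and>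
    y X = \<infinity> \<and> y (swap_in p q X) \<noteq> \<infinity>"
  proof (rule ccontr)
    assume neg: "\<not> ?thesis"
    then have inv: "y (swap_in p q X) = \<infinity>"
      if "p = Suc q \<or> q = Suc p" "p \<in> {1..n}" "q \<in> {1..n}" "X \<in> idx n" "q \<in> X" "p \<notin> X" "y X = \<infinity>" for p q X
      using that by blast
    \<comment> \<open>Pushing elements down one step at a time lowers \<open>\<Sum>X\<close> and
      ends at the initial segment of the same size.\<close>
    have base: "y X = \<infinity> \<longleftrightarrow> y {1..card X} = \<infinity>" if "X \<in> idx n" for X
      using that
    proof (induction "\<Sum>X" arbitrary: X rule: less_induct)
      case less
      have X: "X \<subseteq> {1..n}" using less.prems by (simp add: idx_def)
      have finX: "finite X" using X by (rule finite_subset) simp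
      show ?case
      proof (cases "X = {1..card X}")
        case False
        have "\<not> {1..card X} \<subseteq> X" using False finX card_subset_eq[of X "{1..card X}"] by auto
        then obtain e where e: "e \<in> {1..card X}" "e \<notin> X" by blast
        have "\<not> X \<subseteq> {1..card X}" using False card_subset_eq[of "{1..card X}" X] by auto
        then obtain x where x: "x \<in> X" "card X < x" using X by fastforce
        \<comment> \<open>The least element of X above a missing \<open>e\<close>; its predecessor
          is therefore free, and \<open>q\<close> can move down by one.\<close>
        define q where "q = Min {x\<in>X. e < x}"
        have ne: "finite {x\<in>X. e < x}" "{x\<in>X. e < x} \<noteq> {}" using finX x e by auto
        have q: "q \<in> X" "e < q" using Min_in[OF ne] by (auto simp: q_def)
        have qmin: "q \<le> z" if "z \<in> X" "e < z" for z using that ne unfolding q_def by (intro Min_le) auto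
        define p where "p = q - 1"
        have p: "q = Suc p" "p \<in> {1..n}" "q \<in> {1..n}" using q e X by (auto simp: p_def)
        have pX: "p \<notin> X"
        proof
          assume "p \<in> X"
          then have "e < p \<Longrightarrow> q \<le> p" using qmin by simp
          then show False using p(1) q(2) e(2) \<open>p \<in> X\<close> by (cases "p = e") auto
        qed
        note sw = swap_in_idx[OF less.prems p(2) q(1) pX]
        have "\<Sum>(swap_in p q X) = p + \<Sum>(X - {q})" using finX pX by (simp add: swap_in_def)
        also have "\<dots> < \<Sum>X" using finX q(1) p(1) by (simp add: sum.remove[OF finX q(1)])
        finally have IH: "y (swap_in p q X) = \<infinity> \<longleftrightarrow> y {1..card X} = \<infinity>"
          using less.hyps[OF _ sw(1)] sw(2) by simp
        have inverse_swap: "swap_in q p (swap_in p q X) = X" using q(1) pX p(1) by (auto simp: swap_in_def)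
        have "q \<notin> swap_in p q X" "p \<in> swap_in p q X" using p(1) by (auto simp: swap_in_def)
        then have "y (swap_in p q X) = \<infinity> \<Longrightarrow> y X = \<infinity>"
          using inv[OF _ p(3,2) sw(1)] p(1) inverse_swap by simp
        then have "y X = \<infinity> \<longleftrightarrow> y (swap_in p q X) = \<infinity>"
          using inv[OF _ p(2,3) less.prems q(1) pX] p(1) by blast
        then show ?thesis using IH by simp
      qed simp
    qed
    show False using base[OF X0(1)] base[OF Y0(1)] X0 Y0 by simp
  qed
  then show ?thesis using that by blast
qed

lemma trop_pos_sol_of_pos_rel:
  assumes ninf: "\<And>X. y X \<noteq> -\<infinity>"
    and rel: "\<And>I J. ip_pair n I J \<Longrightarrow> pos_rel y I J"
    and ne: "\<And>k. k \<in> {1..n-1} \<Longrightarrow> \<exists>I\<in>idx n. card I = k \<and> y I \<noteq> \<infinity>"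
    and p: "p \<in> ideal_gen (IP_rels n)" "p \<noteq> 0"
  shows "trop_pos_sol y p"
  using ninf rel ne
proof (induction "card {X \<in> idx n. y X = \<infinity>}" arbitrary: y rule: less_induct)
  case less
  have fin_idx: "finite (idx n)" by (rule finite_subset[of _ "Pow {1..n}"]) (auto simp: idx_def)
  show ?case
  proof (cases "\<exists>X0\<in>idx n. y X0 = \<infinity>")
    case False
    \<comment> \<open>All coordinates in \<open>idx n\<close> are finite now. The polynomial may
      still contain other variables, whose infinite values are replaced by m and recovered in the
      limit.\<close>
    define z where "z m X = (if y X = \<infinity> then real m else real_of_ereal (y X))" for m :: nat and X
    have yz: "ereal (z m X) = y X" if "y X \<noteq> \<infinity>" for m X
      using that less.prems(1)[of X] by (cases "y X") (auto simp: z_def)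
    have lim: "((\<lambda>m. ereal (z m X)) \<longlongrightarrow> y X) sequentially" for X
    proof (cases "y X = \<infinity>")
      case True
      then show ?thesis by (simp add: z_def id_nat_ereal_tendsto_PInf)
    qed (simp add: yz)
    have sol: "trop_pos_sol (\<lambda>X. ereal (z m X)) p" for m
    proof (rule trop_pos_sol_finite_point[OF _ p])
      fix I J assume IJ: "ip_pair n I J" "card (J - I) = 3"
      have "ereal (z m (insert j I)) = y (insert j I)" "ereal (z m (J - {j})) = y (J - {j})" if "j \<in> J - I" for j
        using ip_pair_idx[OF IJ(1), of j] that False by (auto intro: yz)
      then show "pos_rel (\<lambda>X. ereal (z m X)) I J"
        using less.prems(2)[OF IJ(1)] unfolding pos_rel_def by auto
    qed
    show ?thesis
      by (rule trop_pos_sol_closed[where z = "\<lambda>m X. ereal (z m X)", OF lim less.prems(1) sequentially_bot sol])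
  next
    case True
    then obtain X0 where X0: "X0 \<in> idx n" "y X0 = \<infinity>" by blast
    then have "card X0 \<in> {1..n-1}" by (auto simp: idx_def)
    from less.prems(3)[OF this] obtain Y0 where "Y0 \<in> idx n" "card Y0 = card X0" "y Y0 \<noteq> \<infinity>" by blast
    from infinite_coordinate_frontier[where y = y, OF X0 this]
    obtain a b X where ab: "a = Suc b \<or> b = Suc a" "a \<in> {1..n}" "b \<in> {1..n}" and X: "X \<in> idx n" "b \<in> X" "a \<notin> X"
      "y X = \<infinity>" "y (swap_in a b X) \<noteq> \<infinity>" by blast
    define z where "z m = elem_op a b (ereal (real m)) y" for m :: nat
    have lim: "((\<lambda>m. z m Y) \<longlongrightarrow> y Y) sequentially" for Y
    proof (cases "b \<in> Y \<and> a \<notin> Y")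
      case True
      have "((\<lambda>m. ereal (real m) + y (swap_in a b Y)) \<longlongrightarrow> \<infinity> + y (swap_in a b Y)) sequentially"
        using less.prems(1)[of "swap_in a b Y"]
        by (intro tendsto_add_ereal_general tendsto_const id_nat_ereal_tendsto_PInf) auto
      then have "((\<lambda>m. min (y Y) (ereal (real m) + y (swap_in a b Y))) \<longlongrightarrow> min (y Y) \<infinity>) sequentially"
        by (intro tendsto_min tendsto_const) simp
      moreover have "z m Y = min (y Y) (ereal (real m) + y (swap_in a b Y))" for m
        using True by (simp add: z_def elem_op_def)
      ultimately show ?thesis by (simp add: min_def)
    next
      case False
      then have "z m Y = y Y" for m by (auto simp: z_def elem_op_def)
      then show ?thesis by simp
    qed
    have sol: "trop_pos_sol (z m) p" for m
    proof (rule less.hyps)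
      have le: "z m Y \<le> y Y" for Y by (simp add: z_def elem_op_le)
      \<comment> \<open>The frontier set X becomes finite and no coordinate increases, so the number
        of infinite coordinates drops for every m.\<close>
      have "z m X \<noteq> \<infinity>"
        using X elem_op_le_swap[of b X a "ereal (real m)" y] by (cases "y (swap_in a b X)") (auto simp: z_def)
      then have "{X \<in> idx n. z m X = \<infinity>} \<subset> {X \<in> idx n. y X = \<infinity>}"
        using le X by (metis (mono_tags, lifting) ereal_infty_less_eq(1) mem_Collect_eq psubsetI subsetI)
      then show "card {X \<in> idx n. z m X = \<infinity>} < card {X \<in> idx n. y X = \<infinity>}"
        using fin_idx by (intro psubset_card_mono) auto
      show "z m Y \<noteq> -\<infinity>" for Y unfolding z_def using less.prems(1) by (rule elem_op_not_MInf)
      show "pos_rel (z m) I J" if "ip_pair n I J" for I J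
        unfolding z_def using ab less.prems(2) that by (rule pos_rel_elem_op)
      show "\<exists>I\<in>idx n. card I = k \<and> z m I \<noteq> \<infinity>" if k: "k \<in> {1..n-1}" for k
      proof -
        obtain I where I: "I \<in> idx n" "card I = k" "y I \<noteq> \<infinity>" using less.prems(3)[OF k] by blast
        then have "z m I \<noteq> \<infinity>" using le[of I] by auto
        then show ?thesis using I by blast
      qed
    qed
    show ?thesis
      by (rule trop_pos_sol_closed[where z = z, OF lim less.prems(1) sequentially_bot sol])
  qed
qed

section \<open>Supports of positive points\<close>

text \<open>In the relation of \<open>X - {x}\<close> and \<open>insert x Y\<close> the term of
  \<open>x\<close> is \<open>y X + y Y\<close>, which is finite. A term dominating it is finite as
  well, and its two factors are the two exchanged sets.\<close>

lemma pos_rel_support_exchange: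
  assumes rel: "\<And>I J. ip_pair n I J \<Longrightarrow> pos_rel y I J"
    and XY: "X \<in> supp y" "Y \<in> supp y" "X \<subseteq> {1..n}" "Y \<subseteq> {1..n}" "card X \<le> card Y"
    and x: "x \<in> X" "x \<notin> Y"
  obtains z where "z \<in> Y" "z \<notin> X" "insert z (X - {x}) \<in> supp y" "insert x (Y - {z}) \<in> supp y"
proof -
  have fin: "finite X" "finite Y" using XY by (auto intro: finite_subset)
  let ?I = "X - {x}" and ?J = "insert x Y"
  have c: "card X = Suc (card ?I)" using fin x by (metis card.remove)
  then have "ip_pair n ?I ?J" using XY x fin by (auto simp: ip_pair_def)
  from rel[OF this] have "pos_rel y ?I ?J" .
  moreover have "x \<in> ?J" "x \<notin> ?I" by auto
  moreover have ss: "insert x ?I = X" "?J - {x} = Y" using x by auto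
  moreover have "y X + y Y < \<infinity>" using XY by (auto simp: supp_def)
  ultimately obtain z where z: "z \<in> ?J" "z \<notin> ?I" "even_sign z ?I ?J \<noteq> even_sign x ?I ?J"
    "y (insert z ?I) + y (?J - {z}) \<le> y X + y Y"
    by (metis (no_types, lifting) pos_relE)
  have zx: "z \<noteq> x" using z by auto
  have "y (insert z ?I) \<noteq> \<infinity>" "y (?J - {z}) \<noteq> \<infinity>" using z(4) \<open>y X + y Y < \<infinity>\<close> by auto
  moreover have "?J - {z} = insert x (Y - {z})" using zx by auto
  ultimately show ?thesis using that[of z] z zx by (auto simp: supp_def)
qed

text \<open>The exchange allows X and Y of different sizes, which covers both the matroid axiom and
  the containments. For the latter, take a set of the required size meeting the given one in as many
  elements as possible; an exchange at a missing element would enlarge the intersection.\<close>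

lemma forms_flag_matroid_supp:
  assumes rel: "\<And>I J. ip_pair n I J \<Longrightarrow> pos_rel y I J"
    and y: "y \<in> points n"
  shows "forms_flag_matroid n (supp y)"
proof -
  have sub: "X \<subseteq> {1..n}" if "X \<in> supp y" for X
    using that y by (auto simp: points_def supp_def idx_def)
  have ne: "\<exists>X\<in>supp y. card X = k" if "k \<in> {1..n-1}" for k
    using that y by (auto simp: points_def supp_def)
  have fin: "finite X" if "X \<in> supp y" for X using sub[OF that] by (rule finite_subset) simp
  have above: "\<exists>Y\<in>supp y. card Y = k \<and> X \<subseteq> Y" if X: "X \<in> supp y" "card X < k" "k \<in> {1..n-1}" for X k
  proof -
    obtain Y0 where Y0: "Y0 \<in> supp y" "card Y0 = k" using ne[OF X(3)] by blast
    have "\<exists>Y. (Y \<in> supp y \<and> card Y = k) \<and> (\<forall>Z. (Z \<in> supp y \<and> card Z = k) \<longrightarrow> card (X \<inter> Z) \<le> card (X \<inter> Y))"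
      using Y0 card_mono[OF fin[OF X(1)]]
      by (intro ex_has_greatest_nat[where b = "Suc (card X)" and k = Y0]) (auto simp: less_Suc_eq_le)
    then obtain Y where Y: "Y \<in> supp y" "card Y = k"
      and max: "\<And>Z. Z \<in> supp y \<Longrightarrow> card Z = k \<Longrightarrow> card (X \<inter> Z) \<le> card (X \<inter> Y)" by blast
    have "X \<subseteq> Y"
    proof (rule ccontr)
      assume "\<not> X \<subseteq> Y"
      then obtain x where x: "x \<in> X" "x \<notin> Y" by blast
      have le: "card X \<le> card Y" using X Y by simp
      obtain z where z: "z \<in> Y" "z \<notin> X" "insert x (Y - {z}) \<in> supp y"
        using pos_rel_support_exchange[where n = n, OF rel X(1) Y(1) sub[OF X(1)] sub[OF Y(1)] le x] by blast
      have "card (insert x (Y - {z})) = k" using x z Y fin[OF Y(1)] by (metis card_insert_disjoint card_Suc_Diff1 finite_Diff Diff_iff)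
      moreover have "X \<inter> insert x (Y - {z}) = insert x (X \<inter> Y)" using x z by auto
      then have "card (X \<inter> insert x (Y - {z})) = Suc (card (X \<inter> Y))" using x fin[OF X(1)] by simp
      ultimately show False using max[OF z(3)] by simp
    qed
    then show ?thesis using Y by blast
  qed
  have below: "\<exists>X\<in>supp y. card X = j \<and> X \<subseteq> Y" if Y: "Y \<in> supp y" "j < card Y" "j \<in> {1..n-1}" for Y j
  proof -
    obtain X0 where X0: "X0 \<in> supp y" "card X0 = j" using ne[OF Y(3)] by blast
    have "\<exists>X. (X \<in> supp y \<and> card X = j) \<and> (\<forall>Z. (Z \<in> supp y \<and> card Z = j) \<longrightarrow> card (Z \<inter> Y) \<le> card (X \<inter> Y))"
      using X0 card_mono[OF fin[OF Y(1)]]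
      by (intro ex_has_greatest_nat[where b = "Suc (card Y)" and k = X0]) (auto simp: less_Suc_eq_le)
    then obtain X where X: "X \<in> supp y" "card X = j"
      and max: "\<And>Z. Z \<in> supp y \<Longrightarrow> card Z = j \<Longrightarrow> card (Z \<inter> Y) \<le> card (X \<inter> Y)" by blast
    have "X \<subseteq> Y"
    proof (rule ccontr)
      assume "\<not> X \<subseteq> Y"
      then obtain x where x: "x \<in> X" "x \<notin> Y" by blast
      have le: "card X \<le> card Y" using X Y by simp
      obtain z where z: "z \<in> Y" "z \<notin> X" "insert z (X - {x}) \<in> supp y"
        using pos_rel_support_exchange[where n = n, OF rel X(1) Y(1) sub[OF X(1)] sub[OF Y(1)] le x] by blast
      have "card (insert z (X - {x})) = j" using x z X fin[OF X(1)] by (metis card_insert_disjoint card_Suc_Diff1 finite_Diff Diff_iff)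
      moreover have "insert z (X - {x}) \<inter> Y = insert z (X \<inter> Y)" using x z by auto
      then have "card (insert z (X - {x}) \<inter> Y) = Suc (card (X \<inter> Y))" using z fin[OF X(1)] by simp
      ultimately show False using max[OF z(3)] by simp
    qed
    then show ?thesis using X by blast
  qed
  have exch: "\<exists>z\<in>B2 - B1. insert z (B1 - {x}) \<in> {I \<in> supp y. card I = k}"
    if B: "B1 \<in> {I \<in> supp y. card I = k}" "B2 \<in> {I \<in> supp y. card I = k}" "x \<in> B1 - B2" for B1 B2 x k
  proof -
    have B': "B1 \<in> supp y" "B2 \<in> supp y" "card B1 \<le> card B2" "x \<in> B1" "x \<notin> B2" using B by auto
    obtain z where z: "z \<in> B2" "z \<notin> B1" "insert z (B1 - {x}) \<in> supp y"
      using pos_rel_support_exchange[where n = n, OF rel B'(1,2) sub[OF B'(1)] sub[OF B'(2)] B'(3-5)] by blast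
    have "card (insert z (B1 - {x})) = card B1" using B z fin[of B1] by (metis card_insert_disjoint card_Suc_Diff1 finite_Diff Diff_iff mem_Collect_eq)
    then show ?thesis using z B by auto
  qed
  show ?thesis
    unfolding forms_flag_matroid_def matroid_bases_def
    using ne sub exch above below by fastforce
qed

theorem theorem4:
  fixes n :: nat
  assumes "n \<ge> 2"
  shows "trop_pos n (ideal_gen (IP_rels n)) = FlDr3M_pos n \<and>
         FlDr3M_pos n = trop_pos n (IP_rels n)"
proof -
  have "trop_pos n (ideal_gen (IP_rels n)) \<subseteq> trop_pos n (IP_rels n)"
    using ideal_gen_superset unfolding trop_pos_def by blast
  moreover have "trop_pos n (IP_rels n) \<subseteq> FlDr3M_pos n"
  proof
    fix y assume y: "y \<in> trop_pos n (IP_rels n)"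
    \<comment> \<open>A two-element \<open>J - I\<close> gives the zero polynomial, on which
      \<open>trop_pos\<close> imposes nothing; this case is supplied by
      \<open>pos_rel_degenerate\<close>.\<close>
    have "pos_rel y I J" if pr: "ip_pair n I J" for I J
    proof (cases "card (J - I) = 2")
      case False
      then have "3 \<le> card (J - I)" "finite J" using ip_pair_card_Diff(1)[OF pr] ip_pair_finite[OF pr] by auto
      then show ?thesis using y ip_rel_in_IP_rels[OF pr] ip_rel_nonzero
        by (auto simp: trop_pos_def intro!: pos_rel_of_trop_pos_sol)
    qed (rule pos_rel_degenerate[OF pr])
    then have "forms_flag_matroid n (supp y)"
      using y by (intro forms_flag_matroid_supp) (auto simp: trop_pos_def)
    then show "y \<in> FlDr3M_pos n"
      using y IP_rels3_subset by (auto simp: FlDr3M_pos_def trop_pos_def)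
  qed
  moreover have "FlDr3M_pos n \<subseteq> trop_pos n (ideal_gen (IP_rels n))"
  proof
    fix y assume y: "y \<in> FlDr3M_pos n"
    then have pt: "y \<in> points n" and fm: "forms_flag_matroid n (supp y)"
      and sol: "\<And>g. g \<in> IP_rels3 n \<Longrightarrow> g \<noteq> 0 \<Longrightarrow> trop_pos_sol y g"
      by (auto simp: FlDr3M_pos_def trop_pos_def)
    have ninf: "y X \<noteq> -\<infinity>" for X using pt by (simp add: points_def)
    have three: "pos_rel y I J" if pr: "ip_pair n I J" "card (J - I) = 3" for I J
      using ip_pair_finite[OF pr(1)] pr sol[OF ip_rel_in_IP_rels3[OF pr]]
      by (intro pos_rel_of_trop_pos_sol) (auto simp: ip_rel_nonzero)
    have "trop_pos_sol y p" if "p \<in> ideal_gen (IP_rels n)" "p \<noteq> 0" for p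
      using pt by (intro trop_pos_sol_of_pos_rel[OF ninf pos_rel_of_three_terms[OF ninf three fm] _ that])
        (auto simp: points_def)
    then show "y \<in> trop_pos n (ideal_gen (IP_rels n))" using pt by (simp add: trop_pos_def)
  qed
  ultimately show ?thesis by blast
qed

end
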